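(* Let $\mathbb{K}$ be a field of characteristic zero. If there exists a finite-dimensional perfect Lie algebra over $\mathbb{K}$ admitting a non-trivial $A_{BD}$-structure, then there exists a finite-dimensional perfect Lie algebra over $\mathbb{K}$ with abelian radical also admitting a non-trivial $A_{BD}$-structure.
   Context: A Lie algebra $\mathfrak{g}$ is perfect if $[\mathfrak{g},\mathfrak{g}]=\mathfrak{g}$; "radical" means the solvable radical. An $A_{BD}$-structure on a Lie algebra $\mathfrak{g}$ is a commutative bilinear product $\circ:\mathfrak{g}\times\mathfrak{g}\to\mathfrak{g}$ with $x\circ[y,z]=[x\circ y,z]+[y,x\circ z]$ for all $x,y,z\in\mathfrak{g}$. It is trivial if it is identically zero. *)

theory Defs
  imports Complex_Main "HOL-Library.Function_Algebras"
begin

text \<open>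
  Lie algebras are given with an explicit carrier, a linear subspace \<open>L\<close> of an ambient vector space.
  A field of characteristic zero is a type \<open>'k :: field_char_0\<close>. HOL cannot quantify
  existentially over types, so an unrestricted ``there is a finite-dimensional Lie algebra
  over \<open>'k\<close>'' is rendered by carriers inside \<open>nat \<Rightarrow> 'k\<close> (whose pointwise addition comes from
  \<open>HOL-Library.Function_Algebras\<close>), which contains a copy of every \<open>'k ^ n\<close>.
\<close>

definition pointwise_scale :: "'k::field \<Rightarrow> (nat \<Rightarrow> 'k) \<Rightarrow> (nat \<Rightarrow> 'k)" where
  "pointwise_scale c f = (\<lambda>i. c * f i)"

lemma vector_space_pointwise_scale: "vector_space pointwise_scale"
  by unfold_locales (auto simp: pointwise_scale_def fun_eq_iff algebra_simps)

context vector_space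
begin

definition bilinear_on :: "'b set \<Rightarrow> ('b \<Rightarrow> 'b \<Rightarrow> 'b) \<Rightarrow> bool" where
  "bilinear_on V f \<longleftrightarrow>
     (\<forall>x\<in>V. \<forall>y\<in>V. f x y \<in> V) \<and>
     (\<forall>x\<in>V. \<forall>y\<in>V. \<forall>z\<in>V. f (x + y) z = f x z + f y z) \<and>
     (\<forall>x\<in>V. \<forall>y\<in>V. \<forall>z\<in>V. f x (y + z) = f x y + f x z) \<and>
     (\<forall>c. \<forall>x\<in>V. \<forall>y\<in>V. f (scale c x) y = scale c (f x y)) \<and>
     (\<forall>c. \<forall>x\<in>V. \<forall>y\<in>V. f x (scale c y) = scale c (f x y))"

end

locale lie_algebra = vector_space scale
  for scale :: "'k::field \<Rightarrow> 'v::ab_group_add \<Rightarrow> 'v" +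
  fixes L :: "'v set" and bracket :: "'v \<Rightarrow> 'v \<Rightarrow> 'v"
  assumes subspace_carrier: "subspace L"
    and bilinear_bracket: "bilinear_on L bracket"
    and bracket_self: "x \<in> L \<Longrightarrow> bracket x x = 0"
    and jacobi: "\<lbrakk>x \<in> L; y \<in> L; z \<in> L\<rbrakk> \<Longrightarrow>
      bracket x (bracket y z) + bracket y (bracket z x) + bracket z (bracket x y) = 0"
begin

definition finite_dimensional :: bool where
  "finite_dimensional \<longleftrightarrow> (\<exists>B. finite B \<and> span B = L)"

definition commutator :: "'v set \<Rightarrow> 'v set \<Rightarrow> 'v set" where
  "commutator A B = span {bracket a b | a b. a \<in> A \<and> b \<in> B}"

definition perfect :: bool where
  "perfect \<longleftrightarrow> commutator L L = L"

definition lie_ideal :: "'v set \<Rightarrow> bool" where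
  "lie_ideal I \<longleftrightarrow> subspace I \<and> I \<subseteq> L \<and> (\<forall>x\<in>L. \<forall>y\<in>I. bracket x y \<in> I)"

definition derived_series :: "nat \<Rightarrow> 'v set \<Rightarrow> 'v set" where
  "derived_series n I = ((\<lambda>J. commutator J J) ^^ n) I"

definition solvable :: "'v set \<Rightarrow> bool" where
  "solvable I \<longleftrightarrow> (\<exists>n. derived_series n I = {0})"

text \<open>The largest solvable ideal with respect to inclusion; see \<open>radical_greatest\<close> below.\<close>
definition radical :: "'v set" where
  "radical = (GREATEST I. lie_ideal I \<and> solvable I)"

definition abelian :: "'v set \<Rightarrow> bool" where
  "abelian A \<longleftrightarrow> (\<forall>x\<in>A. \<forall>y\<in>A. bracket x y = 0)"

definition A_BD_structure :: "('v \<Rightarrow> 'v \<Rightarrow> 'v) \<Rightarrow> bool" where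
  "A_BD_structure p \<longleftrightarrow>
     bilinear_on L p \<and>
     (\<forall>x\<in>L. \<forall>y\<in>L. p x y = p y x) \<and>
     (\<forall>x\<in>L. \<forall>y\<in>L. \<forall>z\<in>L. p x (bracket y z) = bracket (p x y) z + bracket y (p x z))"

definition trivial :: "('v \<Rightarrow> 'v \<Rightarrow> 'v) \<Rightarrow> bool" where
  "trivial p \<longleftrightarrow> (\<forall>x\<in>L. \<forall>y\<in>L. p x y = 0)"

lemma commutator_mono: "A \<subseteq> A' \<Longrightarrow> B \<subseteq> B' \<Longrightarrow> commutator A B \<subseteq> commutator A' B'"
  unfolding commutator_def by (rule span_mono) blast

lemma bracket_closed: "x \<in> L \<Longrightarrow> y \<in> L \<Longrightarrow> bracket x y \<in> L"
  using bilinear_bracket unfolding bilinear_on_def by blast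

lemma bracket_add_left:
  "x \<in> L \<Longrightarrow> y \<in> L \<Longrightarrow> z \<in> L \<Longrightarrow> bracket (x + y) z = bracket x z + bracket y z"
  using bilinear_bracket unfolding bilinear_on_def by blast

lemma bracket_add_right:
  "x \<in> L \<Longrightarrow> y \<in> L \<Longrightarrow> z \<in> L \<Longrightarrow> bracket x (y + z) = bracket x y + bracket x z"
  using bilinear_bracket unfolding bilinear_on_def by blast

lemma bracket_anticomm:
  assumes "x \<in> L" "y \<in> L" shows "bracket x y = - bracket y x"
proof -
  have "x + y \<in> L" using assms subspace_carrier by (simp add: subspace_add)
  then have "bracket (x + y) (x + y) = 0" by (rule bracket_self)
  then have "bracket x y + bracket y x = 0"
    unfolding bracket_add_left[OF assms \<open>x + y \<in> L\<close>] bracket_add_right[OF assms(1) assms]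
      bracket_add_right[OF assms(2) assms] bracket_self[OF assms(1)] bracket_self[OF assms(2)]
    by simp
  then show ?thesis by (simp add: eq_neg_iff_add_eq_0)
qed

lemma lie_ideal_zero: "lie_ideal {0}"
proof -
  have "bracket x 0 = 0" if "x \<in> L" for x
    using bracket_add_right[of x 0 0] that subspace_0[OF subspace_carrier] by simp
  then show ?thesis
    unfolding lie_ideal_def using subspace_0[OF subspace_carrier] by simp
qed

lemma derived_series_Suc:
  "derived_series (Suc n) I = commutator (derived_series n I) (derived_series n I)"
  by (simp add: derived_series_def)

lemma derived_series_add: "derived_series (m + n) I = derived_series m (derived_series n I)"
  by (simp add: derived_series_def funpow_add)

lemma derived_series_mono: "A \<subseteq> B \<Longrightarrow> derived_series n A \<subseteq> derived_series n B"
  by (induction n) (simp_all add: derived_series_Suc commutator_mono, simp add: derived_series_def)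

lemma derived_series_subspace: "subspace I \<Longrightarrow> subspace (derived_series n I)"
  by (cases n) (simp_all add: derived_series_Suc commutator_def, simp add: derived_series_def)

lemma derived_series_subset:
  assumes "lie_ideal I" shows "derived_series n I \<subseteq> I"
proof (induction n)
  case (Suc n)
  have "commutator I I \<subseteq> I"
    using assms unfolding commutator_def lie_ideal_def
    by (intro span_minimal) auto
  then show ?case
    using commutator_mono[OF Suc Suc] by (simp add: derived_series_Suc)
qed (simp add: derived_series_def)

lemma lie_ideal_sum:
  assumes "lie_ideal I" "lie_ideal J"
  shows "lie_ideal {x + y | x y. x \<in> I \<and> y \<in> J}"
  unfolding lie_ideal_def
proof (intro conjI ballI subsetI)
  show "subspace {x + y | x y. x \<in> I \<and> y \<in> J}"
    using assms subspace_sums unfolding lie_ideal_def by blast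
  fix z assume "z \<in> {x + y | x y. x \<in> I \<and> y \<in> J}"
  then obtain x y where xy: "z = x + y" "x \<in> I" "y \<in> J" by blast
  then have L: "x \<in> L" "y \<in> L" using assms unfolding lie_ideal_def by auto
  then show "z \<in> L" using xy subspace_carrier by (simp add: subspace_add)
  fix w assume "w \<in> L"
  then have "bracket w z = bracket w x + bracket w y" "bracket w x \<in> I" "bracket w y \<in> J"
    using xy L assms by (auto simp: bracket_add_right lie_ideal_def)
  then show "bracket w z \<in> {x + y | x y. x \<in> I \<and> y \<in> J}" by blast
qed

lemma derived_series_sum:
  assumes I: "lie_ideal I" and J: "lie_ideal J"
  shows "derived_series n {x + y | x y. x \<in> I \<and> y \<in> J}
    \<subseteq> {x + y | x y. x \<in> derived_series n I \<and> y \<in> J}"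
proof (induction n)
  case (Suc n)
  let ?D = "derived_series n I"
  have DL: "?D \<subseteq> L" and JL: "J \<subseteq> L"
    using derived_series_subset[OF I] I J unfolding lie_ideal_def by auto
  have sub: "subspace {x + y | x y. x \<in> derived_series (Suc n) I \<and> y \<in> J}"
    using I J derived_series_subspace subspace_sums unfolding lie_ideal_def by blast
  have "commutator {x + y | x y. x \<in> ?D \<and> y \<in> J} {x + y | x y. x \<in> ?D \<and> y \<in> J}
      \<subseteq> {x + y | x y. x \<in> derived_series (Suc n) I \<and> y \<in> J}"
    unfolding commutator_def[of "{x + y | x y. x \<in> ?D \<and> y \<in> J}"]
  proof (rule span_minimal[OF _ sub], safe)
    fix a b c d assume m: "a \<in> ?D" "b \<in> J" "c \<in> ?D" "d \<in> J"
    then have L: "a \<in> L" "b \<in> L" "c \<in> L" "d \<in> L" using DL JL by auto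
    have "bracket (a + b) (c + d) = bracket a c + (bracket a d + bracket b c + bracket b d)"
      using L by (simp add: bracket_add_left bracket_add_right subspace_add[OF subspace_carrier])
    moreover have "bracket a c \<in> derived_series (Suc n) I"
      unfolding derived_series_Suc commutator_def by (rule span_base) (use m in blast)
    moreover have "bracket a d + bracket b c + bracket b d \<in> J"
    proof -
      have sJ: "subspace J" using J by (simp add: lie_ideal_def)
      have "bracket a d \<in> J" "bracket b d \<in> J" "bracket c b \<in> J"
        using J L m by (auto simp: lie_ideal_def)
      then show ?thesis
        using bracket_anticomm[OF L(2,3)] sJ by (simp add: subspace_add subspace_diff)
    qed
    ultimately show "\<exists>x y. bracket (a + b) (c + d) = x + y \<and> x \<in> derived_series (Suc n) I \<and> y \<in> J"
      by blast
  qed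
  then show ?case
    using commutator_mono[OF Suc Suc] unfolding derived_series_Suc[of n "{x + y | x y. x \<in> I \<and> y \<in> J}"]
    by (rule subset_trans[rotated])
qed (simp add: derived_series_def)

lemma solvable_sum:
  assumes I: "lie_ideal I" "solvable I" and J: "lie_ideal J" "solvable J"
  shows "solvable {x + y | x y. x \<in> I \<and> y \<in> J}"
proof -
  let ?S = "{x + y | x y. x \<in> I \<and> y \<in> J}"
  obtain m n where m: "derived_series m I = {0}" and n: "derived_series n J = {0}"
    using I J unfolding solvable_def by blast
  have "derived_series m ?S \<subseteq> J"
    using derived_series_sum[OF I(1) J(1), of m] unfolding m by auto
  then have "derived_series (n + m) ?S \<subseteq> {0}"
    using derived_series_mono[of "derived_series m ?S" J n] n by (simp add: derived_series_add)
  moreover have "subspace (derived_series (n + m) ?S)"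
    using lie_ideal_sum[OF I(1) J(1)] derived_series_subspace by (simp add: lie_ideal_def)
  ultimately show ?thesis
    unfolding solvable_def using subspace_0 by blast
qed

lemma radical_greatest:
  assumes "finite_dimensional"
  shows "lie_ideal radical" "solvable radical"
    and "\<And>I. lie_ideal I \<Longrightarrow> solvable I \<Longrightarrow> I \<subseteq> radical"
proof -
  obtain B where B: "finite B" "span B = L"
    using assms unfolding finite_dimensional_def by blast
  define P where "P I \<longleftrightarrow> lie_ideal I \<and> solvable I" for I
  define Q where "Q b \<longleftrightarrow> independent b \<and> P (span b)" for b
  have fin: "finite b \<and> card b \<le> card B" if "independent b" "span b \<subseteq> L" for b
    using independent_span_bound[OF B(1) that(1)] that(2) B(2) span_superset[of b] by blast
  have "solvable {0}" unfolding solvable_def by (rule exI[of _ 0]) (simp add: derived_series_def)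
  then have "Q {}" unfolding Q_def P_def by (simp add: lie_ideal_zero independent_empty)
  moreover have "card b < Suc (card B)" if "Q b" for b
    using fin[of b] that unfolding Q_def P_def lie_ideal_def by (simp add: less_Suc_eq_le)
  ultimately obtain b where b: "Q b" and max: "\<And>c. Q c \<Longrightarrow> card c \<le> card b"
    using ex_has_greatest_nat[of Q "{}" card "Suc (card B)"] by auto
  have R: "P (span b)" using b by (simp add: Q_def)
  have top: "I \<subseteq> span b" if I: "P I" for I
  proof (rule ccontr)
    assume "\<not> I \<subseteq> span b"
    then obtain x where x: "x \<in> I" "x \<notin> span b" by blast
    define S where "S = {u + v | u v. u \<in> span b \<and> v \<in> I}"
    have PS: "P S"
      using R I lie_ideal_sum solvable_sum unfolding P_def S_def by blast
    have "0 \<in> I" using I subspace_0 by (simp add: P_def lie_ideal_def)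
    then have "span b \<subseteq> S" unfolding S_def by force
    moreover have "x \<in> S" unfolding S_def using x(1) span_zero by force
    ultimately have "insert x b \<subseteq> S" using span_superset by blast
    moreover have ind: "independent (insert x b)"
      using b x(2) independent_insertI by (simp add: Q_def)
    ultimately obtain c where c: "insert x b \<subseteq> c" "c \<subseteq> S" "independent c" "S \<subseteq> span c"
      using maximal_independent_subset_extend by blast
    have sS: "subspace S" using PS by (simp add: P_def lie_ideal_def)
    have "span c = S" using c sS span_minimal by blast
    then have "Q c" using c PS by (simp add: Q_def)
    have "finite c" using fin[OF c(3)] \<open>span c = S\<close> PS by (simp add: P_def lie_ideal_def)
    then have "card (insert x b) \<le> card c" using c(1) by (rule card_mono)
    moreover have "finite b" "x \<notin> b" using \<open>finite c\<close> c(1) finite_subset x(2) span_base by auto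
    ultimately show False using max[OF \<open>Q c\<close>] by simp
  qed
  have "radical = span b"
    unfolding radical_def
    by (rule Greatest_equality) (use R top in \<open>auto simp: P_def\<close>)
  then show "lie_ideal radical" "solvable radical"
    and "\<And>I. lie_ideal I \<Longrightarrow> solvable I \<Longrightarrow> I \<subseteq> radical"
    using R top by (auto simp: P_def)
qed

end

end

theory Submission
  imports Defs "HOL-Computational_Algebra.Polynomial" "HOL-Library.Product_Plus"
begin

text \<open>
  Write \<open>\<langle>x, y\<rangle>\<close> for the bracket and \<open>x \<bullet> y\<close> for the product. Among the finite-dimensional perfect
  Lie algebras over the field that carry a nonzero product, choose one, \<open>L\<close>, of minimal dimension.
  It turns out that the radical of \<open>L\<close> itself is abelian. Suppose that the radical is not zero.

  Each \<open>y \<mapsto> x \<bullet> y\<close> is a derivation. Expanding \<open>\<langle>z, y\<rangle> \<bullet> \<langle>u, v\<rangle>\<close> in two ways gives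
  \<open>product_bracket_identity\<close>. If an ideal \<open>C\<close> brackets every product into an ideal \<open>R\<close>, then this
  identity says that, modulo \<open>R\<close>, the expression \<open>\<langle>c \<bullet> u, \<langle>z, v\<rangle>\<rangle>\<close> is symmetric in \<open>u, v\<close> and
  alternating in \<open>z, v\<close>, and a trilinear expression with these symmetries vanishes when 2 is
  invertible. Since \<open>L\<close> is perfect, \<open>C \<bullet> L\<close> is central modulo \<open>R\<close> (\<open>product_bracket_mem\<close>). This is
  used three times. With \<open>C\<close> and \<open>R\<close> both equal to the radical it shows that the radical, hence
  every term of its derived series, is stable under the product (\<open>stable_radical\<close>). A nonzero
  stable ideal contains every product, for otherwise the quotient by it would be a smaller
  example; so all products lie in the last nonzero derived term \<open>J\<close>, which is abelian. With
  \<open>R = 0\<close> it shows that \<open>J \<bullet> L = 0\<close>; therefore every ideal inside \<open>J\<close> is stable, and the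
  intersection \<open>M\<close> of the nonzero ones contains all products and is a minimal ideal. Finally the
  centralizer \<open>C\<close> of \<open>M\<close> satisfies \<open>C \<bullet> L = 0\<close>.

  So the product is really a map from \<open>L/C \<times> L/C\<close> to \<open>M\<close>, and it defines a nonzero product on the
  semidirect product of \<open>L/C\<close> with \<open>M\<close>. By minimality of \<open>L\<close> this algebra is not smaller than \<open>L\<close>,
  that is, \<open>C = M\<close> (\<open>semidirect_smaller\<close>).

  It remains to see that the radical centralizes \<open>M\<close>. If not, some derived term \<open>A\<close> of the radical
  acts on \<open>M\<close> by commuting operators, not all zero. Each \<open>\<langle>x, a\<rangle>\<close> is then a commutator of
  operators that commutes with one of them, so it is nilpotent in characteristic zero (Jacobson's
  lemma, \<open>commutator_nilpotent\<close>), and simplicity of \<open>M\<close> turns this into \<open>\<langle>L, A\<rangle> \<subseteq> C\<close>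
  (\<open>commuting_ideal_central\<close>). For \<open>a \<in> A\<close> outside \<open>C\<close> the product can now be computed:
  \<open>\<langle>a, \<langle>a, x \<bullet> y\<rangle>\<rangle> = \<langle>y, \<langle>x, a \<bullet> a\<rangle>\<rangle>\<close>. The left side is symmetric in \<open>x, y\<close>, so
  \<open>\<langle>\<langle>x, y\<rangle>, a \<bullet> a\<rangle> = 0\<close>, and by perfectness \<open>\<langle>L, a \<bullet> a\<rangle> = 0\<close>, which makes both sides vanish; as
  \<open>a\<close> acts injectively on \<open>M\<close>, the product is zero, a contradiction
  (\<open>commuting_ideal_le_centralizer\<close>). Hence the radical lies in \<open>C = M\<close>, which is abelian.
\<close>

section \<open>Linear operators on a subspace\<close>

locale char0_vector_space = vector_space scale
  for scale :: "'k::field_char_0 \<Rightarrow> 'v::ab_group_add \<Rightarrow> 'v"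
begin

definition endo_on :: "'v set \<Rightarrow> ('v \<Rightarrow> 'v) \<Rightarrow> bool" where
  "endo_on V f \<longleftrightarrow> (\<forall>v\<in>V. f v \<in> V) \<and> (\<forall>v\<in>V. \<forall>w\<in>V. f (v + w) = f v + f w) \<and>
     (\<forall>c. \<forall>v\<in>V. f (scale c v) = scale c (f v))"

lemma endo_onD:
  assumes "endo_on V f"
  shows endo_on_mem: "v \<in> V \<Longrightarrow> f v \<in> V"
    and endo_on_add: "v \<in> V \<Longrightarrow> w \<in> V \<Longrightarrow> f (v + w) = f v + f w"
    and endo_on_scale: "v \<in> V \<Longrightarrow> f (scale c v) = scale c (f v)"
  using assms unfolding endo_on_def by auto

lemma endo_on_0:
  assumes "subspace V" "endo_on V f" shows "f 0 = 0"
  using endo_on_add[OF assms(2), of 0 0] subspace_0[OF assms(1)] by simp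

lemma endo_on_diff:
  assumes "subspace V" "endo_on V f" "v \<in> V" "w \<in> V" shows "f (v - w) = f v - f w"
proof -
  have "f (v - w) + f w = f v"
    using endo_on_add[OF assms(2), of "v - w" w] assms by (simp add: subspace_diff)
  then show ?thesis by (simp add: eq_diff_eq)
qed

lemma endo_on_neg:
  assumes "subspace V" "endo_on V f" "v \<in> V" shows "f (- v) = - f v"
  using endo_on_diff[OF assms(1,2), of 0 v] assms by (simp add: endo_on_0 subspace_0)

text \<open>
  Take a subspace with property \<open>P\<close> of least dimension: a proper subspace of it has a smaller
  basis.
\<close>
lemma minimal_subspace_exists:
  assumes "finite T" "P S" and P: "\<And>S. P S \<Longrightarrow> subspace S \<and> S \<subseteq> span T"
  obtains W where "P W" "\<And>W'. P W' \<Longrightarrow> W' \<subseteq> W \<Longrightarrow> W' = W"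
proof -
  define Q where "Q n \<longleftrightarrow> (\<exists>S B. P S \<and> independent B \<and> finite B \<and> span B = S \<and> card B = n)" for n
  have basis: "\<exists>B. independent B \<and> finite B \<and> span B = S" if "P S" for S
  proof -
    obtain B where B: "B \<subseteq> S" "independent B" "S \<subseteq> span B"
      using maximal_independent_subset by blast
    then have "finite B" using independent_span_bound[OF assms(1)] P[OF that] by blast
    moreover have "span B = S" using B P[OF that] span_minimal by blast
    ultimately show ?thesis using B by blast
  qed
  have "\<exists>n. Q n" using basis[OF assms(2)] assms(2) unfolding Q_def by blast
  then obtain n where n: "Q n" "\<And>m. m < n \<Longrightarrow> \<not> Q m"
    using exists_least_iff[of Q] by blast
  then obtain W B where W: "P W" "independent B" "finite B" "span B = W" "card B = n"
    unfolding Q_def by blast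
  show thesis
  proof (rule that[OF W(1)])
    fix W' assume W': "P W'" "W' \<subseteq> W"
    obtain B' where B': "independent B'" "finite B'" "span B' = W'" using basis[OF W'(1)] by blast
    show "W' = W"
    proof (rule ccontr)
      assume "W' \<noteq> W"
      then obtain x where x: "x \<in> W" "x \<notin> span B'" using W' B' by blast
      have "insert x B' \<subseteq> span B"
        using x W W' B' span_superset by blast
      then have "card (insert x B') \<le> n"
        using independent_span_bound[OF W(3) independent_insertI[OF x(2) B'(1)]] W by simp
      moreover have "x \<notin> B'" using x span_base by blast
      ultimately have "card B' < n" using B' by simp
      then show False using n(2) W' B' unfolding Q_def by blast
    qed
  qed
qed

text \<open>
  The value \<open>q(f) v\<close> of a polynomial in the operator \<open>f\<close> at the vector \<open>v\<close>, by Horner's scheme.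
\<close>
definition poly_apply :: "'k poly \<Rightarrow> ('v \<Rightarrow> 'v) \<Rightarrow> 'v \<Rightarrow> 'v" where
  "poly_apply q f = fold_coeffs (\<lambda>c g v. scale c v + f (g v)) q (\<lambda>_. 0)"

lemma poly_apply_0 [simp]: "poly_apply 0 f v = 0"
  by (simp add: poly_apply_def)

lemma poly_apply_pCons:
  "f 0 = 0 \<Longrightarrow> poly_apply (pCons c q) f v = scale c v + f (poly_apply q f v)"
  by (cases "q = 0"; cases "c = 0") (auto simp: poly_apply_def)

lemma poly_apply_mem:
  assumes "subspace V" "endo_on V f" "v \<in> V" shows "poly_apply q f v \<in> V"
  by (induction q)
    (use assms in \<open>auto simp: poly_apply_pCons endo_on_0[OF assms(1,2)] endo_on_mem[OF assms(2)]
      subspace_0 subspace_add subspace_scale\<close>)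

lemma poly_apply_endo:
  assumes "subspace V" "endo_on V f" shows "endo_on V (poly_apply q f)"
proof -
  note s = poly_apply_mem[OF assms] poly_apply_pCons[where f = f, OF endo_on_0[OF assms]] endo_on_add[OF assms(2)]
    endo_on_scale[OF assms(2)] subspace_add[OF assms(1)] subspace_scale[OF assms(1)]
  have "poly_apply q f (v + w) = poly_apply q f v + poly_apply q f w" if "v \<in> V" "w \<in> V" for v w
    using that by (induction q) (auto simp: s scale_right_distrib algebra_simps)
  moreover have "poly_apply q f (scale c v) = scale c (poly_apply q f v)" if "v \<in> V" for c v
    using that by (induction q) (auto simp: s scale_right_distrib mult.commute)
  ultimately show ?thesis using poly_apply_mem[OF assms] by (simp add: endo_on_def)
qed

lemma poly_apply_add:
  assumes "subspace V" "endo_on V f" "v \<in> V"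
  shows "poly_apply (p + q) f v = poly_apply p f v + poly_apply q f v"
proof (induction p q rule: poly_induct2)
  case (pCons a p b q)
  then show ?case
    using poly_apply_mem[OF assms] assms
    by (simp add: poly_apply_pCons endo_on_0[OF assms(1,2)] endo_on_add[OF assms(2)]
        scale_left_distrib algebra_simps)
qed simp

lemma poly_apply_smult:
  assumes "subspace V" "endo_on V f" "v \<in> V"
  shows "poly_apply (smult c q) f v = scale c (poly_apply q f v)"
  by (induction q)
    (use assms poly_apply_mem[OF assms] in \<open>auto simp: poly_apply_pCons endo_on_0[OF assms(1,2)]
      endo_on_scale[OF assms(2)] scale_right_distrib\<close>)

lemma poly_apply_mult:
  assumes "subspace V" "endo_on V f" "v \<in> V"
  shows "poly_apply (p * q) f v = poly_apply p f (poly_apply q f v)"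
  by (induction p)
    (use assms in \<open>auto simp: poly_apply_pCons endo_on_0[OF assms(1,2)] mult_pCons_left
      poly_apply_add[OF assms(1,2) poly_apply_mem[OF assms]]
      poly_apply_add[OF assms(1,2)] poly_apply_smult[OF assms(1,2)] poly_apply_mem[OF assms]\<close>)

lemma poly_apply_monom:
  assumes "subspace V" "endo_on V f" "v \<in> V"
  shows "poly_apply (monom 1 k) f v = (f ^^ k) v"
  by (induction k) (use assms in \<open>auto simp: poly_apply_pCons endo_on_0[OF assms(1,2)] monom_Suc
     monom_0\<close>)

text \<open>
  If no polynomial in \<open>f\<close> killed \<open>v\<close>, then the iterates \<open>v, f v, f (f v), \<dots>\<close> would be linearly
  independent.
\<close>
lemma annihilating_poly_vector:
  assumes "subspace V" "endo_on V f" "v \<in> V" and T: "finite T" "V \<subseteq> span T"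
  shows "\<exists>q. q \<noteq> 0 \<and> poly_apply q f v = 0"
proof (rule ccontr)
  assume none: "\<not> ?thesis"
  have inV: "(f ^^ k) v \<in> V" for k
    by (induction k) (use assms endo_on_mem[OF assms(2)] in auto)
  let ?P = "\<lambda>k. (\<lambda>i. (f ^^ i) v) ` {..<k}"
  have new: "(f ^^ k) v \<notin> span (?P k)" for k
  proof
    assume mem: "(f ^^ k) v \<in> span (?P k)"
    have "\<exists>q. (\<forall>i\<ge>k. coeff q i = 0) \<and> poly_apply q f v = w" if "w \<in> span (?P k)" for w
      using that
    proof (induction rule: span_induct_alt)
      case base
      show ?case by (rule exI[of _ 0]) simp
    next
      case (step c x y)
      then obtain i q where i: "i < k" "x = (f ^^ i) v"
        and q: "\<forall>i\<ge>k. coeff q i = 0" "poly_apply q f v = y" by auto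
      show ?case
        by (rule exI[of _ "smult c (monom 1 i) + q"])
          (use i q in \<open>auto simp: poly_apply_add[OF assms(1-3)] poly_apply_smult[OF assms(1-3)]
            poly_apply_monom[OF assms(1-3)]\<close>)
    qed
    then obtain q where q: "\<forall>i\<ge>k. coeff q i = 0" "poly_apply q f v = (f ^^ k) v"
      using mem by blast
    let ?r = "monom 1 k + smult (- 1) q"
    have "coeff ?r k = 1" using q by simp
    then have "?r \<noteq> 0" by auto
    moreover have "poly_apply ?r f v = 0"
      unfolding poly_apply_add[OF assms(1-3)] poly_apply_smult[OF assms(1-3)]
      using q(2) by (simp add: poly_apply_monom[OF assms(1-3)])
    ultimately show False using none by blast
  qed
  have "independent (?P k) \<and> card (?P k) = k" for k
  proof (induction k)
    case (Suc k)
    have "?P (Suc k) = insert ((f ^^ k) v) (?P k)" by (auto simp: lessThan_Suc)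
    moreover have "(f ^^ k) v \<notin> ?P k" by (rule contrapos_nn[OF new[of k]]) (rule span_base)
    ultimately show ?case using Suc new[of k] independent_insertI by simp
  qed (simp add: independent_empty)
  moreover have "?P k \<subseteq> span T" for k unfolding image_subset_iff using inV T(2) by blast
  ultimately show False
    using independent_span_bound[OF T(1), of "?P (Suc (card T))"] by auto
qed

text \<open>
  Polynomials that kill the members of a finite spanning set one by one commute with each other,
  so their product kills the whole space.
\<close>
lemma annihilating_poly:
  assumes "subspace V" "endo_on V f" and T: "finite T" "V = span T"
  shows "\<exists>q. q \<noteq> 0 \<and> (\<forall>v\<in>V. poly_apply q f v = 0)"
proof -
  have "S \<subseteq> V \<longrightarrow> (\<exists>q. q \<noteq> 0 \<and> (\<forall>v\<in>S. poly_apply q f v = 0))" if "finite S" for S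
    using that
  proof (induction S)
    case empty
    show ?case by (rule impI, rule exI[of _ 1]) simp
  next
    case (insert s S)
    show ?case
    proof
      assume S: "insert s S \<subseteq> V"
      obtain p where p: "p \<noteq> 0" "\<forall>v\<in>S. poly_apply p f v = 0" using insert S by auto
      obtain q where q: "q \<noteq> 0" "poly_apply q f s = 0"
        using annihilating_poly_vector[OF assms(1,2) _ T(1)] T(2) S by auto
      note mult = poly_apply_mult[OF assms(1,2)]
      have z: "poly_apply r f 0 = 0" for r
        by (rule endo_on_0[OF assms(1) poly_apply_endo[OF assms(1,2)]])
      have "poly_apply (p * q) f v = 0" if "v \<in> insert s S" for v
      proof (cases "v = s")
        case True
        then show ?thesis using mult[of s p q] S q z by simp
      next
        case False
        then have "v \<in> S" "v \<in> V" using that S by auto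
        then show ?thesis using mult[of v q p] p z by (simp add: mult.commute)
      qed
      then show "\<exists>q. q \<noteq> 0 \<and> (\<forall>v\<in>insert s S. poly_apply q f v = 0)"
        using p q by (intro exI[of _ "p * q"]) simp
    qed
  qed
  moreover have "T \<subseteq> V" using T span_superset by auto
  ultimately obtain q where q: "q \<noteq> 0" "\<forall>v\<in>T. poly_apply q f v = 0" using T by blast
  have "subspace {v \<in> V. poly_apply q f v = 0}"
    using assms poly_apply_endo[OF assms(1,2), of q] endo_on_0[OF assms(1) poly_apply_endo[OF assms(1,2)]]
    by (auto simp: endo_on_def subspace_def)
  then have "span T \<subseteq> {v \<in> V. poly_apply q f v = 0}"
    using q \<open>T \<subseteq> V\<close> by (intro span_minimal) auto
  then show ?thesis using q T by auto
qed

end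

text \<open>
  The setting of Jacobson's lemma for operators on a finite-dimensional space: \<open>z\<close> is the
  commutator of \<open>x\<close> and \<open>y\<close>, and it commutes with \<open>y\<close>. The last assumption is the equation
  \<open>[x, z] z = z [x, z]\<close> written without differences.
\<close>
locale commutator_commuting = char0_vector_space scale
  for scale :: "'k::field_char_0 \<Rightarrow> 'v::ab_group_add \<Rightarrow> 'v" +
  fixes V T :: "'v set" and x y z :: "'v \<Rightarrow> 'v"
  assumes V: "finite T" "V = span T"
    and endo: "endo_on V x" "endo_on V y" "endo_on V z"
    and commutator: "v \<in> V \<Longrightarrow> x (y v) = y (x v) + z v"
    and zy: "v \<in> V \<Longrightarrow> z (y v) = y (z v)"
    and zxz: "v \<in> V \<Longrightarrow> x (z (z v)) + z (z (x v)) = z (x (z v)) + z (x (z v))"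
begin

lemma sub: "subspace V" using V by simp

lemmas simps = endo_on_mem[OF endo(1)] endo_on_mem[OF endo(2)] endo_on_mem[OF endo(3)]
  endo_on_add[OF endo(1)] endo_on_add[OF endo(2)] endo_on_add[OF endo(3)]
  endo_on_scale[OF endo(1)] endo_on_scale[OF endo(2)] endo_on_scale[OF endo(3)]
  endo_on_0[OF sub endo(1)] endo_on_0[OF sub endo(2)] endo_on_0[OF sub endo(3)]
  subspace_0[OF sub] subspace_add[OF sub] subspace_diff[OF sub] subspace_scale[OF sub]
  poly_apply_mem[OF sub endo(2)]

lemma z_power_mem: "v \<in> V \<Longrightarrow> (z ^^ k) v \<in> V"
  by (induction k) (auto simp: simps)

lemma z_power_endo: "endo_on V (z ^^ k)"
  by (induction k) (use endo in \<open>auto simp: endo_on_def\<close>)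

lemma z_poly: "v \<in> V \<Longrightarrow> z (poly_apply q y v) = poly_apply q y (z v)"
  by (induction q) (auto simp: poly_apply_pCons simps zy)

text \<open>
  Because \<open>z\<close> commutes with \<open>y\<close>, commuting with \<open>x\<close> differentiates polynomials in \<open>y\<close>:
  \<open>[x, q(y)] = q'(y) z\<close>.
\<close>
lemma x_poly:
  "v \<in> V \<Longrightarrow> x (poly_apply q y v) = poly_apply q y (x v) + poly_apply (pderiv q) y (z v)"
proof (induction q)
  case (pCons c q)
  show ?case
    using pCons
    by (simp add: poly_apply_pCons simps commutator z_poly poly_apply_add[OF sub endo(2)]
        pderiv_pCons algebra_simps)
qed (simp add: simps)

text \<open>
  Moving \<open>x\<close> past a power of \<open>z\<close> costs at most one factor \<open>z\<close>, since
  \<open>x z^(k+1) = z^(k+1) x + (k+1) z^k [x, z]\<close>.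
\<close>
lemma x_z_power: "v \<in> V \<Longrightarrow> \<exists>u\<in>V. x ((z ^^ Suc k) v) = (z ^^ k) u"
proof (induction k arbitrary: v)
  case 0
  then show ?case by (auto simp: simps)
next
  case (Suc k)
  then obtain u where u: "u \<in> V" "x ((z ^^ Suc k) v) = (z ^^ k) u" by blast
  let ?w = "\<lambda>v. x (z v) - z (x v)"
  have w: "?w ((z ^^ j) v) = (z ^^ j) (?w v)" for j
  proof (induction j)
    case (Suc j)
    let ?v = "(z ^^ j) v"
    have m: "?v \<in> V" using Suc.prems \<open>v \<in> V\<close> z_power_mem by simp
    have "z (?w ?v) + z (z (x ?v)) = z (x (z ?v))"
      using endo_on_add[OF endo(3), of "?w ?v" "z (x ?v)"] m by (simp add: simps)
    then have "z (?w ?v) = z (x (z ?v)) - z (z (x ?v))" by (simp add: eq_diff_eq)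
    also have "\<dots> = ?w (z ?v)" using zxz[OF m] by (simp add: algebra_simps)
    finally have "?w (z ?v) = z (?w ?v)" ..
    then show ?case using Suc by simp
  qed simp
  have "x ((z ^^ Suc (Suc k)) v) = z (x ((z ^^ Suc k) v)) + ?w ((z ^^ Suc k) v)"
    by simp
  also have "\<dots> = (z ^^ Suc k) u + (z ^^ Suc k) (?w v)"
    unfolding w using u by simp
  also have "\<dots> = (z ^^ Suc k) (u + ?w v)"
    using endo_on_add[OF z_power_endo, of u "?w v" "Suc k"] u Suc.prems by (simp add: simps del: funpow.simps)
  finally show ?case
    using u Suc.prems by (intro bexI[of _ "u + ?w v"]) (auto simp: simps)
qed

text \<open>
  Apply \<open>x\<close> to \<open>q(y) z^(k+1) v = 0\<close>. By the derivation rule the result is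
  \<open>q(y) (x z^(k+1) v) + q'(y) z^(k+2) v\<close>, and the first summand has the form \<open>q(y) z^k u\<close>.
\<close>
lemma pderiv_kills:
  assumes "\<And>v. v \<in> V \<Longrightarrow> poly_apply q y ((z ^^ k) v) = 0" "v \<in> V"
  shows "poly_apply (pderiv q) y ((z ^^ Suc (Suc k)) v) = 0"
proof -
  obtain u where u: "u \<in> V" "x ((z ^^ Suc k) v) = (z ^^ k) u"
    using x_z_power assms(2) by blast
  have "poly_apply q y ((z ^^ Suc k) v) = z (poly_apply q y ((z ^^ k) v))"
    using assms(2) by (simp add: z_poly z_power_mem)
  then have "0 = x (poly_apply q y ((z ^^ Suc k) v))"
    using assms by (simp add: simps)
  also have "\<dots> = poly_apply q y ((z ^^ k) u) + poly_apply (pderiv q) y (z ((z ^^ Suc k) v))"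
    using x_poly[OF z_power_mem[OF assms(2)], of q "Suc k"] u(2) by simp
  finally show ?thesis using assms(1)[OF u(1)] by simp
qed

text \<open>
  A nonzero polynomial with \<open>q(y) = 0\<close> on \<open>V\<close> exists. Differentiating it at the cost of two more
  factors \<open>z\<close> ends, in characteristic zero, with a nonzero constant times a power of \<open>z\<close>.
\<close>
theorem commutator_nilpotent: "\<exists>k. \<forall>v\<in>V. (z ^^ k) v = 0"
proof -
  have *: "\<exists>k. \<forall>v\<in>V. (z ^^ k) v = 0"
    if "q \<noteq> 0" "\<And>v. v \<in> V \<Longrightarrow> poly_apply q y ((z ^^ k) v) = 0" for q k
    using that
  proof (induction "degree q" arbitrary: q k)
    case 0
    then obtain c where c: "q = [:c:]" "c \<noteq> 0" by (metis degree_eq_zeroE pCons_eq_0_iff)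
    then have "(z ^^ k) v = 0" if "v \<in> V" for v
      using 0(3)[OF that] by (simp add: poly_apply_pCons simps)
    then show ?case by blast
  next
    case (Suc d)
    then have "pderiv q \<noteq> 0" "d = degree (pderiv q)"
      by (auto simp: pderiv_eq_0_iff degree_pderiv)
    then show ?case using Suc.hyps(1)[of "pderiv q"] pderiv_kills[OF Suc.prems(2)] by blast
  qed
  obtain q where "q \<noteq> 0" "\<forall>v\<in>V. poly_apply q y v = 0"
    using annihilating_poly[OF sub endo(2) V] by blast
  then show ?thesis using *[of q 0] by simp
qed

end

section \<open>Identities for the product\<close>

locale perfect_abd = lie_algebra scale L bracket + char0_vector_space scale
  for scale :: "'k::field_char_0 \<Rightarrow> 'v::ab_group_add \<Rightarrow> 'v" and L :: "'v set"
    and bracket (\<open>\<langle>_,/ _\<rangle>\<close>) +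
  fixes p :: "'v \<Rightarrow> 'v \<Rightarrow> 'v" (infixl \<open>\<bullet>\<close> 70)
  assumes perfect: "perfect" and abd: "A_BD_structure p"
begin

lemma product_bilinear: "bilinear_on L p"
  using abd by (simp add: A_BD_structure_def)

lemma product_commute: "x \<in> L \<Longrightarrow> y \<in> L \<Longrightarrow> x \<bullet> y = y \<bullet> x"
  using abd by (simp add: A_BD_structure_def)

lemma product_derivation:
  "x \<in> L \<Longrightarrow> y \<in> L \<Longrightarrow> z \<in> L \<Longrightarrow> x \<bullet> \<langle>y, z\<rangle> = \<langle>x \<bullet> y, z\<rangle> + \<langle>y, x \<bullet> z\<rangle>"
  using abd by (simp add: A_BD_structure_def)

lemma endo_on_bilinear:
  assumes "bilinear_on L f" "x \<in> L"
  shows "endo_on L (f x)" "endo_on L (\<lambda>y. f y x)"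
  using assms unfolding bilinear_on_def endo_on_def by auto

lemmas bracket_endo = endo_on_bilinear[OF bilinear_bracket]
lemmas product_endo = endo_on_bilinear[OF product_bilinear]

lemmas carrier_simps =
  subspace_0[OF subspace_carrier] subspace_add[OF subspace_carrier]
  subspace_diff[OF subspace_carrier] subspace_neg[OF subspace_carrier]
  subspace_scale[OF subspace_carrier]
  bracket_closed endo_on_mem[OF product_endo(1)]

lemmas bilinear_simps =
  endo_on_0[OF subspace_carrier bracket_endo(1)] endo_on_0[OF subspace_carrier bracket_endo(2)]
  endo_on_0[OF subspace_carrier product_endo(1)] endo_on_0[OF subspace_carrier product_endo(2)]
  bracket_add_left bracket_add_right
  endo_on_add[OF product_endo(1)] endo_on_add[OF product_endo(2)]
  endo_on_diff[OF subspace_carrier bracket_endo(1)] endo_on_diff[OF subspace_carrier bracket_endo(2)]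
  endo_on_diff[OF subspace_carrier product_endo(1)] endo_on_diff[OF subspace_carrier product_endo(2)]
  endo_on_neg[OF subspace_carrier bracket_endo(1)] endo_on_neg[OF subspace_carrier bracket_endo(2)]
  endo_on_scale[OF bracket_endo(1)] endo_on_scale[OF bracket_endo(2)]
  endo_on_scale[OF product_endo(1)] endo_on_scale[OF product_endo(2)]

lemma bracket_derivation:
  assumes "x \<in> L" "y \<in> L" "z \<in> L"
  shows "\<langle>x, \<langle>y, z\<rangle>\<rangle> = \<langle>\<langle>x, y\<rangle>, z\<rangle> + \<langle>y, \<langle>x, z\<rangle>\<rangle>"
proof -
  have "\<langle>y, \<langle>z, x\<rangle>\<rangle> = - \<langle>y, \<langle>x, z\<rangle>\<rangle>" "\<langle>z, \<langle>x, y\<rangle>\<rangle> = - \<langle>\<langle>x, y\<rangle>, z\<rangle>"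
    using assms bracket_anticomm[of z x] bracket_anticomm[of z "\<langle>x, y\<rangle>"]
    by (simp_all add: carrier_simps bilinear_simps)
  then show ?thesis using jacobi[OF assms] by (simp add: algebra_simps add_eq_0_iff)
qed

lemma lie_idealD:
  assumes "lie_ideal I"
  shows ideal_subspace: "subspace I" and ideal_carrier: "x \<in> I \<Longrightarrow> x \<in> L"
    and ideal_bracket: "x \<in> L \<Longrightarrow> y \<in> I \<Longrightarrow> \<langle>x, y\<rangle> \<in> I"
    and ideal_bracket': "x \<in> L \<Longrightarrow> y \<in> I \<Longrightarrow> \<langle>y, x\<rangle> \<in> I"
proof -
  show *: "subspace I" "x \<in> I \<Longrightarrow> x \<in> L" "x \<in> L \<Longrightarrow> y \<in> I \<Longrightarrow> \<langle>x, y\<rangle> \<in> I" for x y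
    using assms by (auto simp: lie_ideal_def)
  then show "x \<in> L \<Longrightarrow> y \<in> I \<Longrightarrow> \<langle>y, x\<rangle> \<in> I"
    using bracket_anticomm[of y x] subspace_neg by metis
qed

lemma perfect_span: "L = span {\<langle>a, b\<rangle> | a b. a \<in> L \<and> b \<in> L}"
  using perfect by (simp add: perfect_def commutator_def)

lemma perfect_induct:
  assumes "endo_on L f" "subspace R" "\<And>a b. a \<in> L \<Longrightarrow> b \<in> L \<Longrightarrow> f \<langle>a, b\<rangle> \<in> R" "x \<in> L"
  shows "f x \<in> R"
proof -
  have "subspace {x \<in> L. f x \<in> R}"
    using assms(1,2) subspace_carrier endo_on_0[OF subspace_carrier assms(1)]
    by (auto simp: endo_on_def subspace_def)
  then have "span {\<langle>a, b\<rangle> | a b. a \<in> L \<and> b \<in> L} \<subseteq> {x \<in> L. f x \<in> R}"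
    using assms(3) by (intro span_minimal) (auto simp: carrier_simps)
  then show ?thesis using perfect_span assms(4) by auto
qed

lemma product_bracket_left:
  assumes "z \<in> L" "y \<in> L" "u \<in> L"
  shows "\<langle>z, y\<rangle> \<bullet> u = \<langle>z, y \<bullet> u\<rangle> - \<langle>y, z \<bullet> u\<rangle>"
  using assms product_commute[of u "\<langle>z, y\<rangle>"] product_derivation[of u z y]
    product_commute[of u z] product_commute[of u y] bracket_anticomm[of "z \<bullet> u" y]
  by (simp add: carrier_simps)

text \<open>
  Expand \<open>\<langle>z, y\<rangle> \<bullet> \<langle>u, v\<rangle>\<close> with \<open>\<langle>z, y\<rangle> \<bullet> _\<close> as a derivation, and again with
  \<open>product_bracket_left\<close>. Composing the derivation \<open>y \<bullet> _\<close> with an inner one is not a derivation,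
  and the identity equates the two resulting defects.
\<close>
lemma product_bracket_identity:
  assumes "y \<in> L" "z \<in> L" "u \<in> L" "v \<in> L"
  shows "\<langle>y \<bullet> u, \<langle>z, v\<rangle>\<rangle> + \<langle>\<langle>z, u\<rangle>, y \<bullet> v\<rangle> = \<langle>z \<bullet> u, \<langle>y, v\<rangle>\<rangle> + \<langle>\<langle>y, u\<rangle>, z \<bullet> v\<rangle>"
proof -
  note s = carrier_simps bilinear_simps assms
  have "\<langle>z, y\<rangle> \<bullet> \<langle>u, v\<rangle> = \<langle>\<langle>z, y \<bullet> u\<rangle>, v\<rangle> - \<langle>\<langle>y, z \<bullet> u\<rangle>, v\<rangle> + (\<langle>u, \<langle>z, y \<bullet> v\<rangle>\<rangle> - \<langle>u, \<langle>y, z \<bullet> v\<rangle>\<rangle>)"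
    using product_derivation[of "\<langle>z, y\<rangle>" u v] by (simp add: s product_bracket_left)
  moreover have "\<langle>z, y\<rangle> \<bullet> \<langle>u, v\<rangle> = \<langle>z, \<langle>y \<bullet> u, v\<rangle>\<rangle> + \<langle>z, \<langle>u, y \<bullet> v\<rangle>\<rangle> - (\<langle>y, \<langle>z \<bullet> u, v\<rangle>\<rangle> + \<langle>y, \<langle>u, z \<bullet> v\<rangle>\<rangle>)"
    using product_bracket_left[of z y "\<langle>u, v\<rangle>"] by (simp add: s product_derivation)
  ultimately show ?thesis
    using bracket_derivation[of z "y \<bullet> u" v] bracket_derivation[of z u "y \<bullet> v"]
      bracket_derivation[of y "z \<bullet> u" v] bracket_derivation[of y u "z \<bullet> v"]
    by (simp add: s algebra_simps)
qed

text \<open>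
  Modulo \<open>R\<close> the right side of \<open>product_bracket_identity\<close> vanishes for \<open>y = c\<close>. What remains is
  the symmetry of \<open>\<langle>c \<bullet> u, \<langle>z, v\<rangle>\<rangle>\<close> in \<open>u, v\<close>, which together with its antisymmetry in \<open>z, v\<close>
  forces it into \<open>R\<close>. The brackets \<open>\<langle>z, v\<rangle>\<close> span \<open>L\<close>.
\<close>
lemma product_bracket_mem:
  assumes R: "lie_ideal R" and C: "lie_ideal C"
    and CR: "\<And>c x y. c \<in> C \<Longrightarrow> x \<in> L \<Longrightarrow> y \<in> L \<Longrightarrow> \<langle>c, x \<bullet> y\<rangle> \<in> R"
    and m: "c \<in> C" "u \<in> L" "w \<in> L"
  shows "\<langle>c \<bullet> u, w\<rangle> \<in> R"
proof -
  have sR: "subspace R" and c: "c \<in> L" using R C m lie_idealD by auto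
  define T where "T u v z = \<langle>c \<bullet> u, \<langle>z, v\<rangle>\<rangle>" for u v z
  have sym: "T u v z - T v u z \<in> R" if "u \<in> L" "v \<in> L" "z \<in> L" for u v z
  proof -
    have "\<langle>c, v\<rangle> \<in> C" "\<langle>c, u\<rangle> \<in> C" using ideal_bracket'[OF C] m that by auto
    then have "\<langle>\<langle>c, v\<rangle>, z \<bullet> u\<rangle> \<in> R" "\<langle>\<langle>c, u\<rangle>, z \<bullet> v\<rangle> \<in> R" using CR that by auto
    moreover have "T u v z - T v u z = \<langle>\<langle>c, u\<rangle>, z \<bullet> v\<rangle> - \<langle>\<langle>c, v\<rangle>, z \<bullet> u\<rangle>"
      using product_bracket_identity[OF c that(3,1,2)] that c
        bracket_anticomm[of "z \<bullet> u" "\<langle>c, v\<rangle>"] bracket_anticomm[of "c \<bullet> v" "\<langle>z, u\<rangle>"]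
      by (simp add: T_def carrier_simps algebra_simps)
    ultimately show ?thesis using subspace_diff[OF sR] by simp
  qed
  have alt: "T u v z = - T u z v" if "u \<in> L" "v \<in> L" "z \<in> L" for u v z
    using that c bracket_anticomm[of z v] unfolding T_def
    by (simp add: carrier_simps bilinear_simps)
  have T: "T u v z \<in> R" if "u \<in> L" "v \<in> L" "z \<in> L" for u v z
  proof -
    \<comment> \<open>Three transpositions in \<open>u, v\<close> alternating with three in \<open>z, v\<close> return \<open>T u v z\<close> with a minus sign.\<close>
    have "(T u v z - T v u z) - (T v z u - T z v u) + (T z u v - T u z v) \<in> R"
      using sym that subspace_add[OF sR] subspace_diff[OF sR] by simp
    moreover have "T v z u = - T v u z" "T z v u = - T z u v" "T u z v = - T u v z"
      using alt that by blast+
    ultimately have "T u v z + T u v z \<in> R" by simp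
    then have "scale (1 / 2) (T u v z + T u v z) \<in> R" by (rule subspace_scale[OF sR])
    moreover have "scale (1 / 2) (T u v z + T u v z) = scale (1 / 2 + 1 / 2) (T u v z)"
      unfolding scale_left_distrib scale_right_distrib ..
    ultimately show ?thesis by simp
  qed
  show ?thesis
    by (rule perfect_induct[OF bracket_endo(1) sR _ m(3)])
      (use T m c in \<open>auto simp: T_def carrier_simps\<close>)
qed

text \<open>
  A derivation with central values vanishes on brackets, hence on a perfect algebra.
\<close>
lemma product_eq_0_of_central:
  assumes "c \<in> L" "\<And>u w. u \<in> L \<Longrightarrow> w \<in> L \<Longrightarrow> \<langle>c \<bullet> u, w\<rangle> = 0" "u \<in> L"
  shows "c \<bullet> u = 0"
proof -
  have "c \<bullet> u \<in> {0}"
  proof (rule perfect_induct[OF product_endo(1)[OF assms(1)] subspace_single_0 _ assms(3)])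
    fix a b assume ab: "a \<in> L" "b \<in> L"
    then show "c \<bullet> \<langle>a, b\<rangle> \<in> {0}"
      using assms(1,2) bracket_anticomm[of a "c \<bullet> b"]
      by (simp add: product_derivation carrier_simps)
  qed
  then show ?thesis by simp
qed

lemma centralizer_product_eq_0:
  assumes "lie_ideal C" "\<And>c x y. c \<in> C \<Longrightarrow> x \<in> L \<Longrightarrow> y \<in> L \<Longrightarrow> \<langle>c, x \<bullet> y\<rangle> = 0" "c \<in> C" "u \<in> L"
  shows "c \<bullet> u = 0"
  using product_bracket_mem[OF lie_ideal_zero assms(1)] assms ideal_carrier[OF assms(1)]
  by (intro product_eq_0_of_central) auto

lemma ideal_Inter:
  assumes "N \<noteq> {}" and N: "\<And>I. I \<in> N \<Longrightarrow> lie_ideal I"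
  shows "lie_ideal (\<Inter>N)"
  unfolding lie_ideal_def
proof (intro conjI ballI)
  show "subspace (\<Inter>N)" using N ideal_subspace by (intro subspace_Inter) blast
  show "\<Inter>N \<subseteq> L" using assms ideal_carrier by fast
  show "\<langle>x, y\<rangle> \<in> \<Inter>N" if "x \<in> L" "y \<in> \<Inter>N" for x y
    using that N ideal_bracket by (intro InterI) auto
qed

definition stable_ideal :: "'v set \<Rightarrow> bool" where
  "stable_ideal I \<longleftrightarrow> lie_ideal I \<and> (\<forall>x\<in>L. \<forall>y\<in>I. x \<bullet> y \<in> I)"

text \<open>
  With \<open>D\<close> inner this makes derived terms of ideals ideals; with \<open>D = x \<bullet> _\<close> it makes derived
  terms of stable ideals stable.
\<close>
lemma derivation_commutator:
  assumes D: "endo_on L D" "\<And>a b. a \<in> L \<Longrightarrow> b \<in> L \<Longrightarrow> D \<langle>a, b\<rangle> = \<langle>D a, b\<rangle> + \<langle>a, D b\<rangle>"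
    and I: "I \<subseteq> L" "\<And>a. a \<in> I \<Longrightarrow> D a \<in> I" and x: "x \<in> commutator I I"
  shows "D x \<in> commutator I I"
proof -
  let ?S = "{x \<in> L. D x \<in> commutator I I}"
  have sub: "subspace (commutator I I)" by (simp add: commutator_def)
  have "subspace ?S"
    using D(1) sub subspace_carrier endo_on_0[OF subspace_carrier D(1)]
    by (auto simp: endo_on_def subspace_def)
  moreover have "\<langle>a, b\<rangle> \<in> ?S" if "a \<in> I" "b \<in> I" for a b
  proof -
    have "\<langle>D a, b\<rangle> \<in> commutator I I" "\<langle>a, D b\<rangle> \<in> commutator I I"
      using that I(2) unfolding commutator_def by (auto intro!: span_base)
    moreover have "a \<in> L" "b \<in> L" using that I(1) by auto
    ultimately show ?thesis
      using D(2)[of a b] sub by (simp add: carrier_simps subspace_add)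
  qed
  ultimately have "commutator I I \<subseteq> ?S"
    unfolding commutator_def by (intro span_minimal) auto
  then show ?thesis using x by auto
qed

lemma ideal_commutator:
  assumes "lie_ideal I" shows "lie_ideal (commutator I I)"
proof -
  have "commutator I I \<subseteq> L"
    using derived_series_subset[OF assms, of 1] assms by (auto simp: derived_series_def lie_ideal_def)
  moreover have "\<langle>x, y\<rangle> \<in> commutator I I" if "x \<in> L" "y \<in> commutator I I" for x y
    by (rule derivation_commutator[OF bracket_endo(1) bracket_derivation])
      (use assms that in \<open>auto simp: lie_ideal_def\<close>)
  ultimately show ?thesis by (simp add: lie_ideal_def commutator_def)
qed

lemma ideal_derived_series: "lie_ideal I \<Longrightarrow> lie_ideal (derived_series n I)"
  by (induction n) (simp_all add: derived_series_Suc ideal_commutator, simp add: derived_series_def)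

lemma stable_derived_series:
  assumes "stable_ideal I" shows "stable_ideal (derived_series n I)"
proof (induction n)
  case 0
  then show ?case using assms by (simp add: derived_series_def)
next
  case (Suc n)
  let ?I = "derived_series n I"
  have I: "lie_ideal ?I" "\<And>x y. x \<in> L \<Longrightarrow> y \<in> ?I \<Longrightarrow> x \<bullet> y \<in> ?I"
    using Suc by (auto simp: stable_ideal_def)
  have "x \<bullet> y \<in> commutator ?I ?I" if "x \<in> L" "y \<in> commutator ?I ?I" for x y
    by (rule derivation_commutator[OF product_endo(1)[OF that(1)]])
      (use I that ideal_carrier[OF I(1)] in \<open>auto simp: product_derivation\<close>)
  then show ?case
    using ideal_commutator[OF I(1)] by (simp add: stable_ideal_def derived_series_Suc)
qed

lemma ideal_into_mod:
  assumes R: "lie_ideal R" shows "lie_ideal {x \<in> L. \<forall>w\<in>L. \<langle>w, x\<rangle> \<in> R}" (is "lie_ideal ?Z")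
proof -
  have "subspace ?Z"
    using ideal_subspace[OF R] by (auto simp: subspace_def carrier_simps bilinear_simps)
  moreover have "\<langle>x, y\<rangle> \<in> ?Z" if "x \<in> L" "y \<in> ?Z" for x y
    using that ideal_bracket[OF R] by (auto simp: carrier_simps)
  ultimately show ?thesis by (auto simp: lie_ideal_def)
qed

text \<open>
  The quotient by the radical has no centre: the preimage of its centre is an ideal whose first
  derived term lies in the radical, so it is solvable.
\<close>
lemma central_mod_radical:
  assumes "finite_dimensional" "x \<in> L" "\<And>w. w \<in> L \<Longrightarrow> \<langle>x, w\<rangle> \<in> radical"
  shows "x \<in> radical"
proof -
  note R = radical_greatest[OF assms(1)]
  let ?Z = "{x \<in> L. \<forall>w\<in>L. \<langle>w, x\<rangle> \<in> radical}"
  have Z: "lie_ideal ?Z" by (rule ideal_into_mod[OF R(1)])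
  have "derived_series 1 ?Z \<subseteq> radical"
    unfolding One_nat_def derived_series_Suc unfolding commutator_def
    by (intro span_minimal[OF _ ideal_subspace[OF R(1)]]) (auto simp: derived_series_def)
  moreover obtain n where "derived_series n radical = {0}" using R(2) by (auto simp: solvable_def)
  ultimately have "derived_series (n + 1) ?Z \<subseteq> {0}"
    using derived_series_mono[of "derived_series 1 ?Z" radical n]
    by (simp add: derived_series_add del: add_Suc_right One_nat_def)
  moreover have "0 \<in> derived_series (n + 1) ?Z"
    using subspace_0 derived_series_subspace Z ideal_subspace by blast
  ultimately have "solvable ?Z" unfolding solvable_def by blast
  then have "?Z \<subseteq> radical" by (rule R(3)[OF Z])
  moreover have "x \<in> ?Z"
    using assms(2,3) bracket_anticomm[OF assms(2)] ideal_subspace[OF R(1)] subspace_neg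
    by (smt (verit) bracket_anticomm mem_Collect_eq)
  ultimately show ?thesis by blast
qed

text \<open>
  With both ideals of \<open>product_bracket_mem\<close> equal to the radical, \<open>radical \<bullet> L\<close> is central modulo
  the radical, hence contained in it.
\<close>
theorem stable_radical:
  assumes "finite_dimensional" shows "stable_ideal radical"
proof -
  note R = radical_greatest(1)[OF assms]
  have "x \<bullet> y \<in> radical" if xy: "x \<in> L" "y \<in> radical" for x y
  proof -
    have y: "y \<in> L" using R xy ideal_carrier by blast
    have "\<langle>y \<bullet> x, w\<rangle> \<in> radical" if "w \<in> L" for w
      by (rule product_bracket_mem[OF R R _ xy(2,1) that])
        (use R ideal_bracket' in \<open>auto simp: carrier_simps\<close>)
    then have "y \<bullet> x \<in> radical" using central_mod_radical[OF assms] xy y by (simp add: carrier_simps)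
    then show ?thesis using product_commute[OF xy(1) y] by simp
  qed
  then show ?thesis using R by (simp add: stable_ideal_def)
qed

end

section \<open>An algebra of minimal dimension has abelian radical\<close>

text \<open>
  The two ways in which minimality of the dimension is used. If the first assumption failed, the
  quotient by \<open>I\<close> would be a smaller algebra with a nonzero product. The hypotheses on \<open>C\<close> and \<open>M\<close>
  in the second one make the semidirect product of \<open>L/C\<close> with \<open>M\<close> a perfect algebra with a nonzero
  product, and its dimension is smaller than that of \<open>L\<close> unless \<open>C = M\<close>.
\<close>
locale minimal_abd = perfect_abd scale L bracket p
  for scale :: "'k::field_char_0 \<Rightarrow> 'v::ab_group_add \<Rightarrow> 'v" and L :: "'v set"
    and bracket (\<open>\<langle>_,/ _\<rangle>\<close>) and p (infixl \<open>\<bullet>\<close> 70) +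
  assumes finite_dim: "finite_dimensional" and nontrivial: "\<not> trivial p"
    and product_in_stable: "stable_ideal I \<Longrightarrow> I \<noteq> {0} \<Longrightarrow> x \<in> L \<Longrightarrow> y \<in> L \<Longrightarrow> x \<bullet> y \<in> I"
    and centralizer_minimal: "\<lbrakk>lie_ideal C; lie_ideal M; M \<subseteq> C; \<And>c m. c \<in> C \<Longrightarrow> m \<in> M \<Longrightarrow> \<langle>c, m\<rangle> = 0;
        commutator L M = M; \<And>c x. c \<in> C \<Longrightarrow> x \<in> L \<Longrightarrow> c \<bullet> x = 0;
        \<And>x y. x \<in> L \<Longrightarrow> y \<in> L \<Longrightarrow> x \<bullet> y \<in> M\<rbrakk> \<Longrightarrow> C = M"
begin

lemma product_not_zero: "\<not> (\<forall>x\<in>L. \<forall>y\<in>L. x \<bullet> y = 0)"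
  using nontrivial by (simp add: trivial_def)

definition monolith :: "'v set \<Rightarrow> bool" where
  "monolith M \<longleftrightarrow> lie_ideal M \<and> M \<noteq> {0} \<and> abelian M \<and> (\<forall>x\<in>L. \<forall>y\<in>L. x \<bullet> y \<in> M) \<and>
    (\<forall>I. lie_ideal I \<and> I \<subseteq> M \<longrightarrow> I = {0} \<or> I = M)"

text \<open>
  The intersection of the nonzero ideals inside the last nonzero derived term \<open>J\<close> of the radical.
  It is not zero because each of these ideals contains all products: \<open>J\<close> centralizes the products,
  so \<open>J \<bullet> L = 0\<close> and every ideal inside \<open>J\<close> is stable.
\<close>
lemma monolith_exists:
  assumes "radical \<noteq> {0}" obtains M where "monolith M"
proof -
  have stab: "stable_ideal (derived_series n radical)" for n
    by (intro stable_derived_series stable_radical finite_dim)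
  obtain m where "derived_series m radical = {0}"
    using radical_greatest(2)[OF finite_dim] by (auto simp: solvable_def)
  moreover have "derived_series 0 radical \<noteq> {0}" using assms by (simp add: derived_series_def)
  ultimately obtain k where k: "derived_series (Suc k) radical = {0}" "derived_series k radical \<noteq> {0}"
    using ex_least_nat_less[of "\<lambda>n. derived_series n radical = {0}" m] by blast
  define J where "J = derived_series k radical"
  have J: "lie_ideal J" "stable_ideal J" "J \<noteq> {0}"
    using stab[of k] k by (auto simp: J_def stable_ideal_def)
  have JJ: "\<langle>a, b\<rangle> = 0" if "a \<in> J" "b \<in> J" for a b
  proof -
    have "\<langle>a, b\<rangle> \<in> commutator J J"
      unfolding commutator_def using that by (intro span_base) blast
    then show ?thesis using k(1) by (simp add: J_def derived_series_Suc)
  qed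
  have LJ: "x \<bullet> y \<in> J" if "x \<in> L" "y \<in> L" for x y
    using product_in_stable J that by blast
  have J0: "c \<bullet> u = 0" if "c \<in> J" "u \<in> L" for c u
    by (rule centralizer_product_eq_0[OF J(1) _ that]) (use JJ LJ in blast)
  let ?N = "{I. lie_ideal I \<and> I \<subseteq> J \<and> I \<noteq> {0}}"
  have LN: "x \<bullet> y \<in> I" if I: "I \<in> ?N" and "x \<in> L" "y \<in> L" for I x y
  proof (rule product_in_stable[OF _ _ that(2,3)])
    have "z \<bullet> w = 0" if "z \<in> L" "w \<in> I" for z w
      using J0[of w z] product_commute[of z w] that I ideal_carrier[of I w] by auto
    then show "stable_ideal I"
      using I subspace_0[OF ideal_subspace] by (auto simp: stable_ideal_def)
  qed (use I in auto)
  define M where "M = \<Inter> ?N"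
  have JN: "J \<in> ?N" using J by simp
  have M: "lie_ideal M"
    unfolding M_def using JN by (intro ideal_Inter) auto
  have LM: "\<forall>x\<in>L. \<forall>y\<in>L. x \<bullet> y \<in> M" using LN by (auto simp: M_def)
  moreover have "M \<noteq> {0}" using LM product_not_zero by auto
  moreover have "abelian M" using JJ JN by (auto simp: abelian_def M_def)
  moreover have "I = {0} \<or> I = M" if "lie_ideal I" "I \<subseteq> M" for I
    using that JN unfolding M_def by blast
  ultimately show thesis using that[of M] M by (simp add: monolith_def)
qed

context
  fixes M assumes M: "monolith M"
begin

definition centralizer :: "'v set" where
  "centralizer = {c \<in> L. \<forall>m\<in>M. \<langle>c, m\<rangle> = 0}"

lemma M_ideal: "lie_ideal M"
  and M_product: "x \<in> L \<Longrightarrow> y \<in> L \<Longrightarrow> x \<bullet> y \<in> M"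
  and M_simple: "lie_ideal I \<Longrightarrow> I \<subseteq> M \<Longrightarrow> I \<noteq> {0} \<Longrightarrow> I = M"
  and M_nonzero: "M \<noteq> {0}"
  and M_abelian: "a \<in> M \<Longrightarrow> b \<in> M \<Longrightarrow> \<langle>a, b\<rangle> = 0"
  using M by (auto simp: monolith_def abelian_def)

lemmas M_carrier = ideal_carrier[OF M_ideal] and M_sub = ideal_subspace[OF M_ideal]

lemma centralizer_ideal: "lie_ideal centralizer"
proof -
  have "subspace centralizer"
    by (auto simp: subspace_def centralizer_def carrier_simps bilinear_simps M_carrier)
  moreover have "\<langle>x, c\<rangle> \<in> centralizer" if x: "x \<in> L" and c: "c \<in> centralizer" for x c
  proof -
    have "\<langle>\<langle>x, c\<rangle>, m\<rangle> = 0" if "m \<in> M" for m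
      using bracket_derivation[of x c m] x c that ideal_bracket[OF M_ideal x that] M_carrier
      by (auto simp: centralizer_def bilinear_simps)
    then show ?thesis using x c by (auto simp: centralizer_def carrier_simps)
  qed
  ultimately show ?thesis by (auto simp: lie_ideal_def centralizer_def)
qed

lemma centralizer_product: "c \<in> centralizer \<Longrightarrow> u \<in> L \<Longrightarrow> c \<bullet> u = 0"
  by (rule centralizer_product_eq_0[OF centralizer_ideal])
    (auto simp: centralizer_def M_product)

text \<open>
  The second assumption holds when brackets \<open>\<langle>x, a\<rangle>\<close> fall into \<open>A\<close> or act as zero. As \<open>M\<close> is a
  minimal ideal, the vectors killed by such an \<open>A\<close> are then all of \<open>M\<close> or only zero.
\<close>
lemma annihilator_ideal:
  assumes "A \<subseteq> L"
    and "\<And>x a v. \<lbrakk>x \<in> L; a \<in> A; v \<in> M; \<And>b. b \<in> A \<Longrightarrow> \<langle>b, v\<rangle> = 0\<rbrakk> \<Longrightarrow> \<langle>\<langle>x, a\<rangle>, v\<rangle> = 0"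
  shows "lie_ideal {v \<in> M. \<forall>a\<in>A. \<langle>a, v\<rangle> = 0}" (is "lie_ideal ?K")
proof -
  have "subspace ?K"
    using subspace_0[OF M_sub] subspace_add[OF M_sub] subspace_scale[OF M_sub] assms(1) M_carrier
    by (auto simp: subspace_def bilinear_simps subset_iff)
  moreover have "\<langle>x, v\<rangle> \<in> ?K" if x: "x \<in> L" and v: "v \<in> ?K" for x v
  proof -
    have "\<langle>a, \<langle>x, v\<rangle>\<rangle> = 0" if a: "a \<in> A" for a
    proof -
      have L: "a \<in> L" "v \<in> L" using a assms(1) v M_carrier by auto
      have "\<langle>\<langle>x, a\<rangle>, v\<rangle> = 0" using assms(2) x a v by blast
      moreover have "\<langle>x, \<langle>a, v\<rangle>\<rangle> = 0" using v a x by (simp add: bilinear_simps)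
      ultimately show ?thesis using bracket_derivation[OF x L] by simp
    qed
    then show ?thesis using v x ideal_bracket[OF M_ideal] by auto
  qed
  ultimately show ?thesis using ideal_carrier[OF M_ideal] by (auto simp: lie_ideal_def)
qed

text \<open>
  If \<open>L\<close> acted trivially on \<open>M\<close>, then all products would be central, and so zero.
\<close>
lemma not_invariant: "v \<in> M \<Longrightarrow> (\<And>x. x \<in> L \<Longrightarrow> \<langle>x, v\<rangle> = 0) \<Longrightarrow> v = 0"
proof -
  assume v: "v \<in> M" "\<And>x. x \<in> L \<Longrightarrow> \<langle>x, v\<rangle> = 0"
  let ?K = "{v \<in> M. \<forall>x\<in>L. \<langle>x, v\<rangle> = 0}"
  have K: "lie_ideal ?K"
    by (rule annihilator_ideal) (auto simp: bracket_closed)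
  have "?K \<noteq> M"
  proof
    assume K: "?K = M"
    have 0: "\<langle>a, x \<bullet> y\<rangle> = 0" if "a \<in> L" "x \<in> L" "y \<in> L" for a x y
      using M_product[OF that(2,3)] K that(1) by blast
    have "\<langle>x \<bullet> y, w\<rangle> = 0" if "x \<in> L" "y \<in> L" "w \<in> L" for x y w
      using 0[of w x y] bracket_anticomm[of "x \<bullet> y" w] that by (simp add: carrier_simps)
    then have "x \<bullet> y = 0" if "x \<in> L" "y \<in> L" for x y
      using that product_eq_0_of_central by blast
    then show False using product_not_zero by blast
  qed
  then have "?K = {0}" using M_simple[OF K] by blast
  then show "v = 0" using v by blast
qed

lemma M_commutator: "commutator L M = M"
proof (rule M_simple)
  let ?C = "commutator L M"
  have gen: "{\<langle>a, b\<rangle> | a b. a \<in> L \<and> b \<in> M} \<subseteq> M" using ideal_bracket[OF M_ideal] by auto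
  then show sub: "?C \<subseteq> M" unfolding commutator_def by (intro span_minimal M_sub)
  have "\<langle>x, y\<rangle> \<in> ?C" if "x \<in> L" "y \<in> ?C" for x y
    unfolding commutator_def using that sub by (intro span_base) blast
  then show "lie_ideal ?C"
    using sub M_carrier by (auto simp: lie_ideal_def commutator_def)
  show "?C \<noteq> {0}"
  proof
    assume "?C = {0}"
    then have "\<langle>x, v\<rangle> = 0" if "x \<in> L" "v \<in> M" for x v
      using that span_base[of "\<langle>x, v\<rangle>" "{\<langle>a, b\<rangle> | a b. a \<in> L \<and> b \<in> M}"] by (auto simp: commutator_def)
    then have "M \<subseteq> {0}" using not_invariant by blast
    then show False using M_nonzero subspace_0[OF M_sub] by blast
  qed
qed

lemma centralizer_eq: "centralizer = M"
  by (rule centralizer_minimal[OF centralizer_ideal M_ideal _ _ M_commutator centralizer_product M_product])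
    (auto simp: centralizer_def M_carrier M_abelian)

text \<open>
  All \<open>\<langle>x, a\<rangle>\<close> act on \<open>M\<close> by commuting nilpotent operators, so they have a common kernel. That
  kernel is a nonzero ideal, hence it is \<open>M\<close>. The common kernel contains any minimal nonzero
  subspace \<open>W\<close> of \<open>M\<close> that \<open>A\<close> preserves: the image of \<open>W\<close> under a nilpotent operator that
  commutes with \<open>A\<close> is again preserved by \<open>A\<close> and is smaller than \<open>W\<close>, so it is zero.
\<close>
lemma commuting_ideal_central:
  assumes A: "lie_ideal A" and AA: "\<And>a b. a \<in> A \<Longrightarrow> b \<in> A \<Longrightarrow> \<langle>a, b\<rangle> \<in> centralizer"
    and m: "x \<in> L" "a \<in> A"
  shows "\<langle>x, a\<rangle> \<in> centralizer"
proof -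
  obtain B where B: "finite B" "span B = L" using finite_dim by (auto simp: finite_dimensional_def)
  obtain T where T: "T \<subseteq> M" "independent T" "M \<subseteq> span T" using maximal_independent_subset by blast
  have "M \<subseteq> span B" using B M_carrier by auto
  then have finT: "finite T" using independent_span_bound[OF B(1) T(2)] T(1) by blast
  have MT: "M = span T" using T M_sub span_minimal by blast
  note AL = ideal_carrier[OF A]
  have comm: "\<langle>a, \<langle>b, v\<rangle>\<rangle> = \<langle>b, \<langle>a, v\<rangle>\<rangle>" if "a \<in> A" "b \<in> A" "v \<in> M" for a b v
    using bracket_derivation[of a b v] AA[OF that(1,2)] that AL M_carrier by (auto simp: centralizer_def)
  have endoM: "endo_on M (bracket x)" if "x \<in> L" for x
    using that ideal_bracket[OF M_ideal] M_carrier by (auto simp: endo_on_def bilinear_simps)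
  have nil: "\<exists>k. \<forall>v\<in>M. (bracket \<langle>x, a\<rangle> ^^ k) v = 0" if xa: "x \<in> L" "a \<in> A" for x a
  proof -
    let ?z = "\<langle>x, a\<rangle>"
    have z: "?z \<in> A" "?z \<in> L" "a \<in> L" using ideal_bracket[OF A xa] AL xa by auto
    interpret commutator_commuting scale M T "bracket x" "bracket a" "bracket ?z"
    proof
      show "endo_on M (bracket x)" "endo_on M (bracket a)" "endo_on M (bracket ?z)"
        using endoM xa z by auto
      fix v assume v: "v \<in> M"
      show "\<langle>x, \<langle>a, v\<rangle>\<rangle> = \<langle>a, \<langle>x, v\<rangle>\<rangle> + \<langle>?z, v\<rangle>"
        using bracket_derivation[of x a v] xa z v M_carrier by simp
      show "\<langle>?z, \<langle>a, v\<rangle>\<rangle> = \<langle>a, \<langle>?z, v\<rangle>\<rangle>" using comm z xa v by simp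
      have zv: "\<langle>?z, v\<rangle> \<in> M" using ideal_bracket[OF M_ideal] z v by simp
      have w: "\<langle>x, ?z\<rangle> \<in> A" using ideal_bracket[OF A] xa z by simp
      have "\<langle>x, \<langle>?z, \<langle>?z, v\<rangle>\<rangle>\<rangle> = \<langle>\<langle>x, ?z\<rangle>, \<langle>?z, v\<rangle>\<rangle> + \<langle>?z, \<langle>x, \<langle>?z, v\<rangle>\<rangle>\<rangle>"
        using bracket_derivation[of x ?z "\<langle>?z, v\<rangle>"] xa z zv M_carrier by simp
      also have "\<langle>\<langle>x, ?z\<rangle>, \<langle>?z, v\<rangle>\<rangle> = \<langle>?z, \<langle>\<langle>x, ?z\<rangle>, v\<rangle>\<rangle>" using comm[OF w z(1) v] .
      also have "\<langle>?z, \<langle>x, \<langle>?z, v\<rangle>\<rangle>\<rangle> = \<langle>?z, \<langle>\<langle>x, ?z\<rangle>, v\<rangle>\<rangle> + \<langle>?z, \<langle>?z, \<langle>x, v\<rangle>\<rangle>\<rangle>"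
        using bracket_derivation[of x ?z v] xa z v M_carrier AL[OF w]
        by (simp add: bilinear_simps carrier_simps)
      finally show "\<langle>x, \<langle>?z, \<langle>?z, v\<rangle>\<rangle>\<rangle> + \<langle>?z, \<langle>?z, \<langle>x, v\<rangle>\<rangle>\<rangle> = \<langle>?z, \<langle>x, \<langle>?z, v\<rangle>\<rangle>\<rangle> + \<langle>?z, \<langle>x, \<langle>?z, v\<rangle>\<rangle>\<rangle>"
        using bracket_derivation[of x ?z v] xa z v M_carrier AL[OF w]
        by (simp add: bilinear_simps carrier_simps algebra_simps)
    qed (use finT MT in auto)
    show ?thesis by (rule commutator_nilpotent)
  qed
  define P where "P S \<longleftrightarrow> subspace S \<and> S \<subseteq> M \<and> S \<noteq> {0} \<and> (\<forall>a\<in>A. \<forall>v\<in>S. \<langle>a, v\<rangle> \<in> S)" for S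
  have "P M" using M_sub M_nonzero ideal_bracket[OF M_ideal] AL by (auto simp: P_def)
  then obtain W where W: "P W" and Wmin: "\<And>W'. P W' \<Longrightarrow> W' \<subseteq> W \<Longrightarrow> W' = W"
    using minimal_subspace_exists[OF finT, of P M] MT by (auto simp: P_def)
  have WM: "v \<in> W \<Longrightarrow> v \<in> M" and W0: "0 \<in> W" for v
    using W subspace_0 by (auto simp: P_def)
  have kill: "\<langle>\<langle>x, a\<rangle>, v\<rangle> = 0" if xa: "x \<in> L" "a \<in> A" and v: "v \<in> W" for x a v
  proof (rule ccontr)
    assume nz: "\<langle>\<langle>x, a\<rangle>, v\<rangle> \<noteq> 0"
    let ?z = "bracket \<langle>x, a\<rangle>"
    have z: "\<langle>x, a\<rangle> \<in> A" "\<langle>x, a\<rangle> \<in> L" using ideal_bracket[OF A xa] AL by auto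
    have "subspace (?z ` W)"
      unfolding subspace_def
    proof (intro conjI allI ballI)
      show "0 \<in> ?z ` W" using W0 z by (auto simp: bilinear_simps intro!: image_eqI[of _ _ 0])
      have sW: "subspace W" using W by (simp add: P_def)
      fix s assume s: "s \<in> ?z ` W"
      show "scale c s \<in> ?z ` W" for c
        using s z WM M_carrier subspace_scale[OF sW, of _ c] by (auto simp: bilinear_simps[symmetric] image_iff)
      show "s + t \<in> ?z ` W" if "t \<in> ?z ` W" for t
        using s that z WM M_carrier subspace_add[OF sW]
        by (auto simp: bracket_add_right[symmetric] image_iff)
    qed
    moreover have "?z ` W \<subseteq> W" using W z by (auto simp: P_def)
    moreover have "?z ` W \<noteq> {0}" using nz v by auto
    moreover have "\<langle>b, s\<rangle> \<in> ?z ` W" if "b \<in> A" "s \<in> ?z ` W" for b s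
      using that W comm[OF that(1) z(1)] WM by (auto simp: P_def)
    ultimately have "P (?z ` W)" "?z ` W \<subseteq> W" using W by (auto simp: P_def)
    then have surj: "?z ` W = W" by (rule Wmin)
    have "(?z ^^ k) ` W = W" for k
    proof (induction k)
      case (Suc k)
      have "(?z ^^ Suc k) ` W = ?z ` (?z ^^ k) ` W" by (simp add: image_comp)
      then show ?case using Suc surj by simp
    qed simp
    moreover obtain k where "\<forall>v\<in>M. (?z ^^ k) v = 0" using nil[OF xa] by blast
    ultimately have "W \<subseteq> {0}" using WM by (metis image_subset_iff insert_iff)
    then show False using W W0 by (auto simp: P_def)
  qed
  let ?Z = "{\<langle>x, a\<rangle> | x a. x \<in> L \<and> a \<in> A}"
  let ?K = "{v \<in> M. \<forall>z\<in>?Z. \<langle>z, v\<rangle> = 0}"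
  have K: "lie_ideal ?K"
  proof (rule annihilator_ideal)
    show "?Z \<subseteq> L" using AL by (auto simp: carrier_simps)
    fix y z assume yz: "y \<in> L" "z \<in> ?Z"
    then have "z \<in> A" using ideal_bracket[OF A] by auto
    then have "\<langle>y, z\<rangle> \<in> ?Z" using yz by blast
    then show "\<langle>\<langle>y, z\<rangle>, v\<rangle> = 0" if "\<And>b. b \<in> ?Z \<Longrightarrow> \<langle>b, v\<rangle> = 0" for v
      using that by blast
  qed
  have "W \<subseteq> ?K" using kill WM by auto
  then have "?K \<noteq> {0}" using W W0 by (auto simp: P_def)
  then have "?K = M" using M_simple[OF K] by blast
  then have "\<langle>\<langle>x, a\<rangle>, v\<rangle> = 0" if "v \<in> M" for v using m that by blast
  then show ?thesis using m AL by (simp add: centralizer_def carrier_simps)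
qed

text \<open>
  An element \<open>a\<close> that is central modulo the centralizer but acts on \<open>M\<close> as a nonzero operator
  commutes with the action of \<open>L\<close> and acts injectively, by minimality of \<open>M\<close>. Dividing by \<open>a\<close>
  expresses the whole product through the single vector \<open>a \<bullet> a\<close>, and commutativity of the product
  makes the brackets, hence \<open>L\<close>, kill this vector.
\<close>
lemma commuting_ideal_le_centralizer:
  assumes A: "lie_ideal A" and AA: "\<And>a b. a \<in> A \<Longrightarrow> b \<in> A \<Longrightarrow> \<langle>a, b\<rangle> \<in> centralizer"
  shows "A \<subseteq> centralizer"
proof (rule ccontr)
  assume "\<not> A \<subseteq> centralizer"
  then obtain a where a: "a \<in> A" "a \<notin> centralizer" by blast
  have aL: "a \<in> L" using a ideal_carrier[OF A] by blast
  have cent: "\<langle>x, a\<rangle> \<in> centralizer" "\<langle>a, x\<rangle> \<in> centralizer" if "x \<in> L" for x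
    using commuting_ideal_central[OF A AA that a(1)] bracket_anticomm[OF aL that]
      subspace_neg[OF ideal_subspace[OF centralizer_ideal]] by auto
  have comm: "\<langle>x, \<langle>a, v\<rangle>\<rangle> = \<langle>a, \<langle>x, v\<rangle>\<rangle>" if "x \<in> L" "v \<in> M" for x v
    using bracket_derivation[of x a v] cent[OF that(1)] that aL M_carrier by (auto simp: centralizer_def)
  note s = M_product aL carrier_simps
  \<comment> \<open>Here \<open>x \<bullet> \<langle>a, y\<rangle> = 0\<close>, because \<open>\<langle>a, y\<rangle>\<close> lies in the centralizer.\<close>
  have swap: "\<langle>a, x \<bullet> y\<rangle> = \<langle>y, x \<bullet> a\<rangle>" if "x \<in> L" "y \<in> L" for x y
  proof -
    have "x \<bullet> \<langle>a, y\<rangle> = 0"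
      using centralizer_product[OF cent(2)[OF that(2)] that(1)] product_commute[of x "\<langle>a, y\<rangle>"] that
      by (simp add: s)
    then show ?thesis
      using product_derivation[of x a y] bracket_anticomm[of "x \<bullet> a" y] that by (simp add: s)
  qed
  have square: "\<langle>a, \<langle>a, x \<bullet> y\<rangle>\<rangle> = \<langle>y, \<langle>x, a \<bullet> a\<rangle>\<rangle>" if "x \<in> L" "y \<in> L" for x y
  proof -
    have "\<langle>a, \<langle>a, x \<bullet> y\<rangle>\<rangle> = \<langle>a, \<langle>y, a \<bullet> x\<rangle>\<rangle>" using swap[OF that] product_commute[of x a] that by (simp add: s)
    also have "\<dots> = \<langle>y, \<langle>a, a \<bullet> x\<rangle>\<rangle>" using comm[of y "a \<bullet> x"] that by (simp add: s)
    also have "\<dots> = \<langle>y, \<langle>x, a \<bullet> a\<rangle>\<rangle>" using swap[OF aL that(1)] by simp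
    finally show ?thesis .
  qed
  have "\<langle>x, a \<bullet> a\<rangle> = 0" if "x \<in> L" for x
  proof -
    have "\<langle>x, a \<bullet> a\<rangle> \<in> {0}"
    proof (rule perfect_induct[OF bracket_endo(2) subspace_single_0 _ that])
      fix u v assume uv: "u \<in> L" "v \<in> L"
      have "\<langle>u, \<langle>v, a \<bullet> a\<rangle>\<rangle> = \<langle>v, \<langle>u, a \<bullet> a\<rangle>\<rangle>"
        using square[OF uv] square[OF uv(2,1)] product_commute[OF uv] by simp
      then show "\<langle>\<langle>u, v\<rangle>, a \<bullet> a\<rangle> \<in> {0}"
        using bracket_derivation[of u v "a \<bullet> a"] uv by (simp add: s)
    qed (simp add: s)
    then show ?thesis by simp
  qed
  then have aa: "\<langle>a, \<langle>a, x \<bullet> y\<rangle>\<rangle> = 0" if "x \<in> L" "y \<in> L" for x y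
    using square[OF that] that by (simp add: bilinear_simps)
  let ?K = "{v \<in> M. \<forall>b\<in>{a}. \<langle>b, v\<rangle> = 0}"
  have "lie_ideal ?K"
    by (rule annihilator_ideal) (use aL cent in \<open>auto simp: centralizer_def\<close>)
  moreover have "?K \<noteq> M" using a aL by (auto simp: centralizer_def)
  ultimately have K: "?K = {0}" using M_simple[of ?K] by blast
  have inj: "v = 0" if "v \<in> M" "\<langle>a, v\<rangle> = 0" for v using K that by blast
  have "x \<bullet> y = 0" if "x \<in> L" "y \<in> L" for x y
    using inj[of "x \<bullet> y"] inj[of "\<langle>a, x \<bullet> y\<rangle>"] aa[OF that] that ideal_bracket[OF M_ideal] by (simp add: s)
  then show False using product_not_zero by blast
qed

text \<open>
  Otherwise the last derived term of the radical outside the centralizer would commute modulo the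
  centralizer.
\<close>
lemma radical_le_centralizer: "radical \<subseteq> centralizer"
proof (rule ccontr)
  assume not: "\<not> radical \<subseteq> centralizer"
  note R = radical_greatest[OF finite_dim]
  have "0 \<in> centralizer" using subspace_0[OF ideal_subspace[OF centralizer_ideal]] .
  then obtain m where "derived_series m radical \<subseteq> centralizer"
    using R(2) unfolding solvable_def by (metis empty_subsetI insert_subset)
  moreover have "\<not> derived_series 0 radical \<subseteq> centralizer" using not by (simp add: derived_series_def)
  ultimately obtain k where k: "derived_series (Suc k) radical \<subseteq> centralizer"
      "\<not> derived_series k radical \<subseteq> centralizer"
    using ex_least_nat_less[of "\<lambda>n. derived_series n radical \<subseteq> centralizer" m] by blast
  let ?A = "derived_series k radical"
  have "\<langle>a, b\<rangle> \<in> centralizer" if "a \<in> ?A" "b \<in> ?A" for a b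
  proof -
    have "\<langle>a, b\<rangle> \<in> derived_series (Suc k) radical"
      unfolding derived_series_Suc commutator_def using that by (intro span_base) blast
    then show ?thesis using k(1) by blast
  qed
  then have "?A \<subseteq> centralizer"
    by (intro commuting_ideal_le_centralizer ideal_derived_series R(1))
  then show False using k(2) by blast
qed

end

theorem abelian_radical: "abelian radical"
proof (cases "radical = {0}")
  case True
  then show ?thesis
    using bilinear_simps(1)[OF subspace_0[OF subspace_carrier]] by (simp add: abelian_def)
next
  case False
  then obtain M where M: "monolith M" by (rule monolith_exists)
  then show ?thesis
    using radical_le_centralizer[OF M] centralizer_eq[OF M] M
    by (auto simp: abelian_def monolith_def subset_iff)
qed

end

section \<open>Quotients in coordinates\<close>

definition coordinate_space :: "nat \<Rightarrow> (nat \<Rightarrow> 'k::zero) set" where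
  "coordinate_space n = {f. \<forall>i\<ge>n. f i = 0}"

text \<open>
  Extend \<open>B0\<close> to a basis \<open>BI\<close> of \<open>I\<close>, and this to a basis \<open>B\<close> of \<open>L\<close>; the map \<open>\<phi>\<close> reads off the
  coordinates at \<open>B - BI\<close>. The bound on \<open>n\<close> involves a spanning set and an independent set rather
  than dimensions, so that lower bounds for \<open>I\<close> can be given by any few independent vectors.
\<close>
lemma (in char0_vector_space) quotient_coordinates:
  assumes T: "finite T" "L \<subseteq> span T" and L: "subspace L" and I: "subspace I" "I \<subseteq> L"
    and B0: "independent B0" "B0 \<subseteq> I"
  obtains n \<phi> where "n + card B0 \<le> card T"
    "\<And>x y. x \<in> L \<Longrightarrow> y \<in> L \<Longrightarrow> \<phi> (x + y) = \<phi> x + \<phi> y"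
    "\<And>c x. x \<in> L \<Longrightarrow> \<phi> (scale c x) = pointwise_scale c (\<phi> x)"
    "\<phi> ` L = coordinate_space n" "\<And>x. x \<in> L \<Longrightarrow> \<phi> x = 0 \<longleftrightarrow> x \<in> I"
proof -
  obtain BI where BI: "B0 \<subseteq> BI" "BI \<subseteq> I" "independent BI" "I \<subseteq> span BI"
    using maximal_independent_subset_extend[OF B0(2,1)] by blast
  have BIL: "BI \<subseteq> L" using BI(2) I(2) by (rule subset_trans)
  obtain B where B: "BI \<subseteq> B" "B \<subseteq> L" "independent B" "L \<subseteq> span B"
    using maximal_independent_subset_extend[OF BIL BI(3)] by blast
  have finB: "finite B" "card B \<le> card T"
    using independent_span_bound[OF T(1) B(3)] B(2) T(2) by (meson subset_trans)+
  define D where "D = B - BI"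
  have finD: "finite D" using finB(1) by (simp add: D_def)
  obtain e where e: "bij_betw e {..<card D} D"
    using ex_bij_betw_nat_finite[OF finD] by (auto simp: atLeast0LessThan)
  define \<phi> where "\<phi> x = (\<lambda>i. if i < card D then representation B x (e i) else 0)" for x
  have eD: "e i \<in> D" if "i < card D" for i using e that by (auto simp: bij_betw_def)
  have eB: "e i \<in> B" if "i < card D" for i using eD[OF that] by (simp add: D_def)
  have LB: "x \<in> span B" if "x \<in> L" for x using B(4) that by (rule subsetD)
  have "card B0 \<le> card BI" using BI(1) B(1) finB(1) by (meson card_mono finite_subset)
  moreover have "card D = card B - card BI" "card BI \<le> card B"
    unfolding D_def using B(1) finB(1) by (auto intro: card_Diff_subset card_mono finite_subset)
  ultimately have card: "card D + card B0 \<le> card T" using finB(2) by linarith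
  have add: "\<phi> (x + y) = \<phi> x + \<phi> y" if "x \<in> L" "y \<in> L" for x y
    by (auto simp: \<phi>_def representation_add[OF B(3) LB[OF that(2)] LB[OF that(1)]])
  have sc: "\<phi> (scale c x) = pointwise_scale c (\<phi> x)" if "x \<in> L" for c x
    by (auto simp: \<phi>_def pointwise_scale_def representation_scale[OF B(3) LB[OF that]])
  have image: "\<phi> ` L = coordinate_space (card D)"
  proof
    show "\<phi> ` L \<subseteq> coordinate_space (card D)" by (auto simp: \<phi>_def coordinate_space_def)
    show "coordinate_space (card D) \<subseteq> \<phi> ` L"
    proof
      fix f :: "nat \<Rightarrow> 'k" assume f: "f \<in> coordinate_space (card D)"
      define x where "x = (\<Sum>i<card D. scale (f i) (e i))"
      have "x \<in> L"
        unfolding x_def using eB B(2) L by (intro subspace_sum subspace_scale) auto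
      have "representation B x (e j) = f j" if j: "j < card D" for j
      proof -
        have inj: "e j = e i \<longleftrightarrow> i = j" if "i < card D" for i
          using e that j by (auto simp: bij_betw_def inj_on_def)
        have "representation B x (e j) = (\<Sum>i<card D. representation B (scale (f i) (e i)) (e j))"
          unfolding x_def using eB by (subst representation_sum[OF B(3)]) (auto intro: span_scale span_base)
        also have "\<dots> = (\<Sum>i<card D. if i = j then f j else 0)"
          using eB inj by (intro sum.cong refl)
            (auto simp: representation_scale[OF B(3) span_base] representation_basis[OF B(3)])
        finally show ?thesis using j by simp
      qed
      then have "\<phi> x = f" using f by (auto simp: \<phi>_def coordinate_space_def)
      then show "f \<in> \<phi> ` L" using \<open>x \<in> L\<close> by blast
    qed
  qed
  have kernel: "\<phi> x = 0 \<longleftrightarrow> x \<in> I" if x: "x \<in> L" for x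
  proof
    assume x0: "\<phi> x = 0"
    have "representation B x b = 0" if "b \<in> D" for b
    proof -
      have "b \<in> e ` {..<card D}" using e that by (simp add: bij_betw_def)
      then obtain i where "i < card D" "b = e i" by auto
      then show ?thesis using fun_cong[OF x0, of i] by (simp add: \<phi>_def)
    qed
    then have "{b. representation B x b \<noteq> 0} \<subseteq> BI"
      using representation_ne_zero[of B x] by (auto simp: D_def)
    then have "(\<Sum>b | representation B x b \<noteq> 0. scale (representation B x b) b) \<in> I"
      using I(1) BI(2) by (intro subspace_sum subspace_scale) auto
    then show "x \<in> I" using sum_nonzero_representation_eq[OF B(3) LB[OF x]] by simp
  next
    assume "x \<in> I"
    then have "x \<in> span BI" using BI(4) by (rule subsetD[rotated])
    then have "representation B x = representation BI x"
      by (rule representation_extend[OF B(3) _ B(1)])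
    moreover have "representation BI x b = 0" if "b \<in> D" for b
      using that representation_ne_zero[of BI x b] by (auto simp: D_def)
    ultimately show "\<phi> x = 0" using eD by (auto simp: \<phi>_def)
  qed
  show thesis by (rule that[OF card add sc image kernel])
qed

text \<open>
  The quotient by \<open>I\<close> is realised on the image of a linear map \<open>\<phi>\<close> with kernel \<open>I\<close>: operations are
  computed on arbitrarily chosen preimages, and \<open>lift\<close> is their independence of the choice.
\<close>
lemma (in perfect_abd) quotient_algebra:
  fixes scale' :: "'k \<Rightarrow> 'w::ab_group_add \<Rightarrow> 'w"
  assumes V: "vector_space scale'"
    and add: "\<And>x y. x \<in> L \<Longrightarrow> y \<in> L \<Longrightarrow> \<phi> (x + y) = \<phi> x + \<phi> y"
    and sc: "\<And>c x. x \<in> L \<Longrightarrow> \<phi> (scale c x) = scale' c (\<phi> x)"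
    and I: "stable_ideal I" and kernel: "\<And>x. x \<in> L \<Longrightarrow> \<phi> x = 0 \<longleftrightarrow> x \<in> I"
  obtains b q where "perfect_abd scale' (\<phi> ` L) b q"
    "\<And>x y. x \<in> L \<Longrightarrow> y \<in> L \<Longrightarrow> q (\<phi> x) (\<phi> y) = \<phi> (x \<bullet> y)"
proof -
  interpret V: vector_space scale' by (rule V)
  have ideal: "lie_ideal I" using I by (simp add: stable_ideal_def)
  note IL = ideal_carrier[OF ideal] and addI = subspace_add[OF ideal_subspace[OF ideal]]
  have zero: "\<phi> 0 = 0" using add[of 0 0] subspace_0[OF subspace_carrier] by simp
  have diff: "\<phi> (x - y) = \<phi> x - \<phi> y" if "x \<in> L" "y \<in> L" for x y
    using add[of "x - y" y] that by (simp add: carrier_simps eq_diff_eq)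
  define s where "s w = (SOME x. x \<in> L \<and> \<phi> x = w)" for w
  have s: "s (\<phi> x) \<in> L \<and> \<phi> (s (\<phi> x)) = \<phi> x" if "x \<in> L" for x
    unfolding s_def by (rule someI_ex) (use that in blast)
  have lift: "\<phi> (f (s (\<phi> x)) (s (\<phi> y))) = \<phi> (f x y)"
    if f: "bilinear_on L f" and fI: "\<And>x y. x \<in> L \<Longrightarrow> y \<in> I \<Longrightarrow> f x y \<in> I" "\<And>x y. x \<in> L \<Longrightarrow> y \<in> I \<Longrightarrow> f y x \<in> I"
      and xy: "x \<in> L" "y \<in> L" for f x y
  proof -
    let ?x = "s (\<phi> x)" and ?y = "s (\<phi> y)"
    have L: "?x \<in> L" "?y \<in> L" using s xy by auto
    have dI: "?x - x \<in> I" "?y - y \<in> I"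
      using kernel[of "?x - x"] kernel[of "?y - y"] diff s xy L by (auto simp: carrier_simps)
    have "f (?x - x) ?y = f ?x ?y - f x ?y" "f x (?y - y) = f x ?y - f x y"
      using endo_on_diff[OF subspace_carrier endo_on_bilinear(2)[OF f L(2)] L(1) xy(1)]
        endo_on_diff[OF subspace_carrier endo_on_bilinear(1)[OF f xy(1)] L(2) xy(2)] by auto
    then have "f ?x ?y - f x y = f (?x - x) ?y + f x (?y - y)" by simp
    also have "\<dots> \<in> I" using fI dI L xy addI by blast
    finally have fd: "f ?x ?y - f x y \<in> I" .
    have fL: "f ?x ?y \<in> L" "f x y \<in> L" using f L xy by (auto simp: bilinear_on_def)
    have "\<phi> (f ?x ?y - f x y) = 0" using fd kernel[OF IL[OF fd]] by blast
    then show ?thesis using diff[OF fL] by simp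
  qed
  define b where "b u w = \<phi> \<langle>s u, s w\<rangle>" for u w
  define q where "q u w = \<phi> (s u \<bullet> s w)" for u w
  have b: "b (\<phi> x) (\<phi> y) = \<phi> \<langle>x, y\<rangle>" if "x \<in> L" "y \<in> L" for x y
    unfolding b_def
    by (rule lift[OF bilinear_bracket _ _ that])
      (use ideal_bracket[OF ideal] ideal_bracket'[OF ideal] in auto)
  have q: "q (\<phi> x) (\<phi> y) = \<phi> (x \<bullet> y)" if "x \<in> L" "y \<in> L" for x y
    unfolding q_def
    by (rule lift[OF product_bilinear _ _ that])
      (use I IL product_commute in \<open>auto simp: stable_ideal_def\<close>)
  note h = add[symmetric] sc[symmetric] b q carrier_simps
  have sub: "V.subspace (\<phi> ` L)"
    unfolding V.subspace_def
    using zero subspace_0[OF subspace_carrier] by (auto simp: h)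
  have bil: "V.bilinear_on (\<phi> ` L) f'"
    if f: "bilinear_on L f" and f': "\<And>x y. x \<in> L \<Longrightarrow> y \<in> L \<Longrightarrow> f' (\<phi> x) (\<phi> y) = \<phi> (f x y)" for f f'
    using f unfolding V.bilinear_on_def bilinear_on_def by (auto simp: h f')
  interpret Q: lie_algebra scale' "\<phi> ` L" b
  proof
    show "V.bilinear_on (\<phi> ` L) b" by (rule bil[OF bilinear_bracket b])
    show "b u u = 0" if "u \<in> \<phi> ` L" for u
      using that zero by (auto simp: h bracket_self)
    show "b u (b v w) + b v (b w u) + b w (b u v) = 0"
      if "u \<in> \<phi> ` L" "v \<in> \<phi> ` L" "w \<in> \<phi> ` L" for u v w
      using that zero by (auto simp: h jacobi)
  qed (rule sub)
  have "Q.perfect"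
    unfolding Q.perfect_def Q.commutator_def
  proof
    let ?S = "{b u w | u w. u \<in> \<phi> ` L \<and> w \<in> \<phi> ` L}"
    show "V.span ?S \<subseteq> \<phi> ` L" by (rule V.span_minimal[OF _ sub]) (auto simp: h)
    have "subspace {x \<in> L. \<phi> x \<in> V.span ?S}"
      using zero by (auto simp: subspace_def carrier_simps add sc V.span_zero V.span_add V.span_scale)
    then have "span {\<langle>x, y\<rangle> | x y. x \<in> L \<and> y \<in> L} \<subseteq> {x \<in> L. \<phi> x \<in> V.span ?S}"
    proof (rule span_minimal[rotated], clarify)
      fix x y assume xy: "x \<in> L" "y \<in> L"
      have "b (\<phi> x) (\<phi> y) \<in> V.span ?S" by (rule V.span_base) (use xy in blast)
      then show "\<langle>x, y\<rangle> \<in> L \<and> \<phi> \<langle>x, y\<rangle> \<in> V.span ?S" using b xy by (simp add: carrier_simps)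
    qed
    then show "\<phi> ` L \<subseteq> V.span ?S" using perfect_span by auto
  qed
  moreover have "Q.A_BD_structure q"
    unfolding Q.A_BD_structure_def
    using bil[OF product_bilinear q] by (auto simp: h product_commute product_derivation)
  ultimately have "perfect_abd scale' (\<phi> ` L) b q"
    by unfold_locales
  then show thesis using q by (rule that)
qed

text \<open>
  Every finite-dimensional algebra has a copy on some coordinate space, so the dimension \<open>n\<close> can
  be minimised over one fixed family of carriers.
\<close>
definition nontrivial_in_dimension :: "'k::field_char_0 itself \<Rightarrow> nat \<Rightarrow> bool" where
  "nontrivial_in_dimension _ n \<longleftrightarrow> (\<exists>b p. perfect_abd pointwise_scale (coordinate_space n :: (nat \<Rightarrow> 'k) set) b p \<and>
     \<not> lie_algebra.trivial (coordinate_space n :: (nat \<Rightarrow> 'k) set) p)"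

lemma (in perfect_abd) nontrivial_quotient:
  assumes T: "finite T" "L \<subseteq> span T" and I: "stable_ideal I"
    and nz: "x \<in> L" "y \<in> L" "x \<bullet> y \<notin> I"
    and B0: "independent B0" "B0 \<subseteq> I"
  shows "\<exists>n. n + card B0 \<le> card T \<and> nontrivial_in_dimension TYPE('k) n"
proof -
  have ideal: "lie_ideal I" using I by (simp add: stable_ideal_def)
  have "I \<subseteq> L" using ideal_carrier[OF ideal] by blast
  then obtain n \<phi> where n: "n + card B0 \<le> card T"
    and \<phi>: "\<And>x y. x \<in> L \<Longrightarrow> y \<in> L \<Longrightarrow> \<phi> (x + y) = \<phi> x + \<phi> y"
      "\<And>c x. x \<in> L \<Longrightarrow> \<phi> (scale c x) = pointwise_scale c (\<phi> x)"
    and image: "\<phi> ` L = coordinate_space n" and kernel: "\<And>x. x \<in> L \<Longrightarrow> \<phi> x = 0 \<longleftrightarrow> x \<in> I"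
    using quotient_coordinates[OF T subspace_carrier ideal_subspace[OF ideal] _ B0] by blast
  obtain b q where bq: "perfect_abd pointwise_scale (\<phi> ` L) b q"
    and q: "\<And>x y. x \<in> L \<Longrightarrow> y \<in> L \<Longrightarrow> q (\<phi> x) (\<phi> y) = \<phi> (x \<bullet> y)"
    using quotient_algebra[OF vector_space_pointwise_scale \<phi> I kernel] by blast
  interpret Q: perfect_abd pointwise_scale "\<phi> ` L" b q by (rule bq)
  have "q (\<phi> x) (\<phi> y) \<noteq> 0" using q nz kernel by (simp add: carrier_simps)
  then have "\<not> Q.trivial q" using nz by (auto simp: Q.trivial_def)
  then show ?thesis using n bq unfolding nontrivial_in_dimension_def image by blast
qed

section \<open>The semidirect product of a quotient with an ideal\<close>

definition prod_scale :: "('k \<Rightarrow> 'v \<Rightarrow> 'v) \<Rightarrow> 'k \<Rightarrow> 'v \<times> 'v \<Rightarrow> 'v \<times> 'v" where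
  "prod_scale s c v = (s c (fst v), s c (snd v))"

context perfect_abd
begin

text \<open>
  The pair \<open>(x, v)\<close> stands for \<open>x + \<epsilon> v\<close> with \<open>\<epsilon>\<^sup>2 = 0\<close>. On \<open>L \<times> M\<close> this is the semidirect product
  of \<open>L\<close> with the module \<open>M\<close>, turned into an abelian ideal.
\<close>
definition semidirect_bracket :: "'v \<times> 'v \<Rightarrow> 'v \<times> 'v \<Rightarrow> 'v \<times> 'v" where
  "semidirect_bracket X Y = (\<langle>fst X, fst Y\<rangle>, \<langle>fst X, snd Y\<rangle> + \<langle>snd X, fst Y\<rangle>)"

text \<open>
  The product of \<open>L\<close> moves to the second component. Its values lie in \<open>M\<close>, hence in the
  centralizer \<open>C\<close> of \<open>M\<close>, so in the first component it would be lost on passing to the quotient by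
  \<open>C \<times> {0}\<close>.
\<close>
definition semidirect_product :: "'v \<times> 'v \<Rightarrow> 'v \<times> 'v \<Rightarrow> 'v \<times> 'v" where
  "semidirect_product X Y = (0, fst X \<bullet> fst Y)"

lemma vector_space_prod_scale: "vector_space (prod_scale scale)"
  by unfold_locales
    (auto simp: prod_scale_def scale_right_distrib scale_left_distrib)

lemma semidirect_abd:
  assumes M: "lie_ideal M" and LM: "commutator L M = M"
    and pM: "\<And>x y. x \<in> L \<Longrightarrow> y \<in> L \<Longrightarrow> x \<bullet> y \<in> M"
  shows "perfect_abd (prod_scale scale) (L \<times> M) semidirect_bracket semidirect_product"
proof -
  interpret V: vector_space "prod_scale scale" by (rule vector_space_prod_scale)
  note carrM = ideal_carrier[OF M] and Msub = ideal_subspace[OF M]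
  note Ms = subspace_0[OF Msub] subspace_add[OF Msub] subspace_scale[OF Msub]
    ideal_bracket[OF M] ideal_bracket'[OF M] pM
  note s = semidirect_bracket_def semidirect_product_def prod_scale_def Ms carrM carrier_simps
    bilinear_simps scale_right_distrib
  interpret H: lie_algebra "prod_scale scale" "L \<times> M" semidirect_bracket
  proof
    show "V.subspace (L \<times> M)" by (auto simp: V.subspace_def zero_prod_def s)
    show "V.bilinear_on (L \<times> M) semidirect_bracket"
      by (auto simp: V.bilinear_on_def s)
    show "semidirect_bracket X X = 0" if "X \<in> L \<times> M" for X
      using that bracket_anticomm[of "fst X" "snd X"]
      by (auto simp: s bracket_self zero_prod_def)
    fix X Y Z assume XYZ: "X \<in> L \<times> M" "Y \<in> L \<times> M" "Z \<in> L \<times> M"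
    obtain x u y v z w where e: "X = (x, u)" "Y = (y, v)" "Z = (z, w)"
      by (cases X, cases Y, cases Z)
    have m: "x \<in> L" "y \<in> L" "z \<in> L" "u \<in> L" "v \<in> L" "w \<in> L" using XYZ e carrM by auto
    \<comment> \<open>The \<open>\<epsilon>\<close>-component of the Jacobi identity is the sum of three Jacobi identities in \<open>L\<close>.\<close>
    have "(\<langle>u, \<langle>y, z\<rangle>\<rangle> + \<langle>y, \<langle>z, u\<rangle>\<rangle> + \<langle>z, \<langle>u, y\<rangle>\<rangle>) + (\<langle>x, \<langle>v, z\<rangle>\<rangle> + \<langle>v, \<langle>z, x\<rangle>\<rangle> + \<langle>z, \<langle>x, v\<rangle>\<rangle>) +
        (\<langle>x, \<langle>y, w\<rangle>\<rangle> + \<langle>y, \<langle>w, x\<rangle>\<rangle> + \<langle>w, \<langle>x, y\<rangle>\<rangle>) = 0"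
      using jacobi[of u y z] jacobi[of x v z] jacobi[of x y w] m by simp
    then show "semidirect_bracket X (semidirect_bracket Y Z) + semidirect_bracket Y (semidirect_bracket Z X) +
        semidirect_bracket Z (semidirect_bracket X Y) = 0"
      using jacobi[of x y z] m
      by (simp add: s e zero_prod_def) (simp add: algebra_simps)
  qed
  have "H.perfect"
    unfolding H.perfect_def H.commutator_def
  proof
    let ?S = "{semidirect_bracket X Y | X Y. X \<in> L \<times> M \<and> Y \<in> L \<times> M}"
    show "V.span ?S \<subseteq> L \<times> M"
      using H.bracket_closed by (intro V.span_minimal H.subspace_carrier) blast
    have "subspace {x. (x, 0) \<in> V.span ?S}" "subspace {x. (0, x) \<in> V.span ?S}"
      using V.span_zero V.span_add[of "(_, 0)" ?S "(_, 0)"] V.span_add[of "(0, _)" ?S "(0, _)"]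
        V.span_scale[of "(_, 0)" ?S] V.span_scale[of "(0, _)" ?S]
      by (auto simp: subspace_def zero_prod_def prod_scale_def)
    note sub = this
    have "(\<langle>x, y\<rangle>, 0) \<in> V.span ?S" if "x \<in> L" "y \<in> L" for x y
    proof -
      have "semidirect_bracket (x, 0) (y, 0) \<in> V.span ?S"
        by (rule V.span_base) (use that Ms in blast)
      then show ?thesis using that by (simp add: s)
    qed
    then have "commutator L L \<subseteq> {x. (x, 0) \<in> V.span ?S}"
      unfolding commutator_def by (intro span_minimal sub) auto
    then have 1: "(x, 0) \<in> V.span ?S" if "x \<in> L" for x using that perfect by (auto simp: perfect_def)
    have "(0, \<langle>x, y\<rangle>) \<in> V.span ?S" if "x \<in> L" "y \<in> M" for x y
    proof -
      have "semidirect_bracket (x, 0) (0, y) \<in> V.span ?S"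
        by (rule V.span_base) (use that Ms carrier_simps in blast)
      then show ?thesis using that by (simp add: s)
    qed
    then have "commutator L M \<subseteq> {x. (0, x) \<in> V.span ?S}"
      unfolding commutator_def by (intro span_minimal sub) auto
    then have 2: "(0, x) \<in> V.span ?S" if "x \<in> M" for x using that LM by auto
    show "L \<times> M \<subseteq> V.span ?S"
    proof clarify
      fix x y assume "x \<in> L" "y \<in> M"
      then show "(x, y) \<in> V.span ?S" using V.span_add[OF 1 2, of x y] by simp
    qed
  qed
  moreover have "H.A_BD_structure semidirect_product"
    unfolding H.A_BD_structure_def
    by (auto simp: V.bilinear_on_def s product_commute product_derivation)
  ultimately show ?thesis by unfold_locales
qed

text \<open>
  The semidirect product of \<open>L/C\<close> with \<open>M\<close> is obtained as the quotient of \<open>L \<times> M\<close> by the stable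
  ideal \<open>C \<times> {0}\<close>. A basis of \<open>M\<close> together with one vector \<open>c\<close> of \<open>C\<close> outside \<open>M\<close> is independent
  in \<open>C\<close>, so the ideal that is divided out has larger dimension than the factor \<open>M\<close> that was
  added.
\<close>
lemma semidirect_smaller:
  assumes T: "finite T" "L = span T" and C: "lie_ideal C" and M: "lie_ideal M" "M \<subseteq> C" "M \<noteq> C"
    and CM: "\<And>c m. c \<in> C \<Longrightarrow> m \<in> M \<Longrightarrow> \<langle>c, m\<rangle> = 0"
    and LM: "commutator L M = M" and C0: "\<And>c x. c \<in> C \<Longrightarrow> x \<in> L \<Longrightarrow> c \<bullet> x = 0"
    and pM: "\<And>x y. x \<in> L \<Longrightarrow> y \<in> L \<Longrightarrow> x \<bullet> y \<in> M"
    and nz: "\<not> trivial p"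
  shows "\<exists>n<card T. nontrivial_in_dimension TYPE('k) n"
proof -
  interpret H: perfect_abd "prod_scale scale" "L \<times> M" semidirect_bracket semidirect_product
    by (rule semidirect_abd[OF M(1) LM pM])
  note carrM = ideal_carrier[OF M(1)] and CL = ideal_carrier[OF C]
  note M0 = subspace_0[OF ideal_subspace[OF M(1)]] and C00 = subspace_0[OF ideal_subspace[OF C]]
  obtain B where B: "B \<subseteq> M" "independent B" "M \<subseteq> span B"
    using maximal_independent_subset by blast
  have "B \<subseteq> span T" using B(1) carrM T(2) by blast
  then have finB: "finite B" using independent_span_bound[OF T(1) B(2)] by blast
  have spanB: "span B = M" using B span_minimal[OF B(1) ideal_subspace[OF M(1)]] by blast
  obtain c where c: "c \<in> C" "c \<notin> M" using M by blast
  have cB: "c \<notin> B" "independent (insert c B)"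
    using c B spanB independent_insertI by auto
  let ?T = "(\<lambda>x. (x, 0)) ` T \<union> (\<lambda>x. (0, x)) ` B"
  let ?B = "(\<lambda>x. (x, 0 :: 'v)) ` insert c B"
  have finT: "finite ?T" using T(1) finB by simp
  have cardT: "card ?T \<le> card T + card B"
    using card_Un_le card_image_le[OF T(1)] card_image_le[OF finB] by (meson add_mono order_trans)
  have "card ?B = card (insert c B)" by (rule card_image) (simp add: inj_on_def)
  then have cardB: "card ?B = card B + 1" using cB finB by simp
  have spanT: "L \<times> M \<subseteq> H.span ?T"
  proof clarify
    have sub: "subspace {x. (x, 0) \<in> H.span ?T}" "subspace {x. (0, x) \<in> H.span ?T}"
      using H.span_zero H.span_add[of "(_, 0)" ?T "(_, 0)"] H.span_add[of "(0, _)" ?T "(0, _)"]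
        H.span_scale[of "(_, 0)" ?T] H.span_scale[of "(0, _)" ?T]
      by (auto simp: subspace_def zero_prod_def prod_scale_def)
    have "span T \<subseteq> {x. (x, 0) \<in> H.span ?T}"
      by (rule span_minimal[OF _ sub(1)]) (auto intro: H.span_base)
    moreover have "span B \<subseteq> {x. (0, x) \<in> H.span ?T}"
      by (rule span_minimal[OF _ sub(2)]) (auto intro: H.span_base)
    moreover fix x y assume "x \<in> L" "y \<in> M"
    ultimately show "(x, y) \<in> H.span ?T"
      using H.span_add[of "(x, 0)" ?T "(0, y)"] T(2) spanB by auto
  qed
  have indB: "H.independent ?B"
    unfolding H.dependent_def
  proof
    assume "\<exists>a\<in>?B. a \<in> H.span (?B - {a})"
    then obtain a where a: "a \<in> insert c B" "(a, 0) \<in> H.span (?B - {(a, 0)})" by blast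
    let ?U = "{X. fst X \<in> span (insert c B - {a})}"
    have "H.subspace ?U"
      by (auto simp: H.subspace_def prod_scale_def span_zero span_add span_scale)
    then have "H.span (?B - {(a, 0)}) \<subseteq> ?U"
      by (rule H.span_minimal[rotated]) (auto intro: span_base)
    then have "a \<in> span (insert c B - {a})" using a(2) by auto
    then show False using cB(2) a(1) by (auto simp: dependent_def)
  qed
  have BC: "?B \<subseteq> C \<times> {0}" using B(1) M(2) c(1) by auto
  have stab: "H.stable_ideal (C \<times> {0})"
  proof -
    have 1: "\<langle>u, d\<rangle> = 0" if "u \<in> M" "d \<in> C" for u d
      using CM[OF that(2,1)] bracket_anticomm[of u d] carrM CL that by simp
    have 2: "x \<bullet> d = 0" if "x \<in> L" "d \<in> C" for x d
      using C0[OF that(2,1)] product_commute[of x d] CL that by simp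
    have "H.subspace (C \<times> {0})"
      using ideal_subspace[OF C] by (auto simp: H.subspace_def subspace_def prod_scale_def zero_prod_def)
    then show ?thesis
      using CL M0 C00 ideal_bracket[OF C] 1 2
      by (auto simp: H.stable_ideal_def H.lie_ideal_def semidirect_bracket_def semidirect_product_def
          bilinear_simps)
  qed
  obtain x y where xy: "x \<in> L" "y \<in> L" "x \<bullet> y \<noteq> 0" using nz by (auto simp: trivial_def)
  then have "semidirect_product (x, 0) (y, 0) \<notin> C \<times> {0}" by (simp add: semidirect_product_def)
  moreover have "(x, 0) \<in> L \<times> M" "(y, 0) \<in> L \<times> M" using xy M0 by auto
  ultimately obtain n where "n + card ?B \<le> card ?T" "nontrivial_in_dimension TYPE('k) n"
    using H.nontrivial_quotient[OF finT spanT stab _ _ _ indB BC] by blast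
  then show ?thesis using cardT cardB by (intro exI[of _ n]) simp
qed

end

section \<open>Existence of a minimal algebra\<close>

lemma coordinate_space_span:
  obtains T :: "(nat \<Rightarrow> 'k::field_char_0) set"
  where "finite T" "card T \<le> n" "module.span pointwise_scale T = coordinate_space n"
proof -
  interpret V: vector_space "pointwise_scale :: 'k \<Rightarrow> _" by (rule vector_space_pointwise_scale)
  let ?e = "\<lambda>i j. if i = j then 1 else (0 :: 'k)"
  let ?T = "?e ` {..<n}"
  have "V.subspace (coordinate_space n)"
    by (auto simp: V.subspace_def coordinate_space_def pointwise_scale_def)
  then have "V.span ?T \<subseteq> coordinate_space n"
    by (rule V.span_minimal[rotated]) (auto simp: coordinate_space_def)
  moreover have "f \<in> V.span ?T" if f: "f \<in> coordinate_space n" for f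
  proof -
    have "(\<Sum>i<m. pointwise_scale (f i) (?e i)) j = (if j < m then f j else 0)" for m j
      by (induction m) (auto simp: pointwise_scale_def less_Suc_eq)
    then have "f = (\<Sum>i<n. pointwise_scale (f i) (?e i))"
      using f by (auto simp: coordinate_space_def fun_eq_iff)
    also have "\<dots> \<in> V.span ?T"
      by (intro V.span_sum V.span_scale V.span_base) auto
    finally show ?thesis .
  qed
  ultimately have "V.span ?T = coordinate_space n" by blast
  then show thesis using that[of ?T] card_image_le[of "{..<n}" ?e] by simp
qed

theorem proposition4p3:
  assumes "\<exists>(scale :: 'k::field_char_0 \<Rightarrow> 'v::ab_group_add \<Rightarrow> 'v) L bracket.
      lie_algebra scale L bracket \<and>
      lie_algebra.finite_dimensional scale L \<and>
      lie_algebra.perfect scale L bracket \<and>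
      (\<exists>p. lie_algebra.A_BD_structure scale L bracket p \<and> \<not> lie_algebra.trivial L p)"
  shows "\<exists>(L :: (nat \<Rightarrow> 'k) set) bracket.
      lie_algebra pointwise_scale L bracket \<and>
      lie_algebra.finite_dimensional pointwise_scale L \<and>
      lie_algebra.perfect pointwise_scale L bracket \<and>
      lie_algebra.abelian bracket (lie_algebra.radical pointwise_scale L bracket) \<and>
      (\<exists>p. lie_algebra.A_BD_structure pointwise_scale L bracket p \<and> \<not> lie_algebra.trivial L p)"
proof -
  let ?good = "nontrivial_in_dimension TYPE('k)"
  obtain scale :: "'k \<Rightarrow> 'v \<Rightarrow> 'v" and L bracket p where g:
    "lie_algebra scale L bracket" "lie_algebra.finite_dimensional scale L"
    "lie_algebra.perfect scale L bracket" "lie_algebra.A_BD_structure scale L bracket p"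
    "\<not> lie_algebra.trivial L p"
    using assms by blast
  interpret G: lie_algebra scale L bracket by (rule g(1))
  interpret G: perfect_abd scale L bracket p
    by unfold_locales (use g in auto)
  obtain T where T: "finite T" "G.span T = L" using g(2) by (auto simp: G.finite_dimensional_def)
  obtain x y where "x \<in> L" "y \<in> L" "p x y \<noteq> 0" using g(5) by (auto simp: G.trivial_def)
  moreover have "G.stable_ideal {0}"
    using G.lie_ideal_zero by (auto simp: G.stable_ideal_def G.bilinear_simps)
  ultimately have "\<exists>n. ?good n"
    using G.nontrivial_quotient[of T "{0}" x y "{}"] T G.independent_empty by auto
  then obtain n where n: "?good n" "\<And>m. m < n \<Longrightarrow> \<not> ?good m"
    using exists_least_iff[of ?good] by metis
  define L' where "L' = (coordinate_space n :: (nat \<Rightarrow> 'k) set)"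
  obtain b q where bq: "perfect_abd pointwise_scale L' b q" "\<not> lie_algebra.trivial L' q"
    using n(1) by (auto simp: nontrivial_in_dimension_def L'_def)
  interpret A: perfect_abd pointwise_scale L' b q by (rule bq(1))
  obtain T' where T': "finite T'" "card T' \<le> n" "A.span T' = L'"
    using coordinate_space_span[of n] unfolding L'_def by metis
  interpret A: minimal_abd pointwise_scale L' b q
  proof
    show "A.finite_dimensional" using T' by (auto simp: A.finite_dimensional_def)
    show "\<not> A.trivial q" by (rule bq(2))
    show "q x y \<in> I" if I: "A.stable_ideal I" "I \<noteq> {0}" and xy: "x \<in> L'" "y \<in> L'" for I x y
    proof (rule ccontr)
      assume "q x y \<notin> I"
      have "0 \<in> I" using I(1) A.subspace_0 by (auto simp: A.stable_ideal_def A.lie_ideal_def)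
      then obtain v where v: "v \<in> I" "v \<noteq> 0" using I(2) by blast
      have "A.independent {v}" using v by simp
      then obtain m where "m + card {v} \<le> card T'" "?good m"
        using A.nontrivial_quotient[of T' I x y "{v}"] T' I xy \<open>q x y \<notin> I\<close> v by auto
      then show False using n(2)[of m] T'(2) by simp
    qed
    show "C = M"
      if h: "A.lie_ideal C" "A.lie_ideal M" "M \<subseteq> C" "\<And>c m. c \<in> C \<Longrightarrow> m \<in> M \<Longrightarrow> b c m = 0"
        "A.commutator L' M = M" "\<And>c x. c \<in> C \<Longrightarrow> x \<in> L' \<Longrightarrow> q c x = 0"
        "\<And>x y. x \<in> L' \<Longrightarrow> y \<in> L' \<Longrightarrow> q x y \<in> M" for C M
    proof (rule ccontr)
      assume "C \<noteq> M"
      then obtain m where "m < card T'" "?good m"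
        using A.semidirect_smaller[OF T'(1) T'(3)[symmetric] h(1,2,3) _ h(4-7) bq(2)] \<open>C \<noteq> M\<close> by blast
      then show False using n(2)[of m] T'(2) by simp
    qed
  qed
  show ?thesis
    using A.lie_algebra_axioms A.finite_dim A.perfect A.abelian_radical A.abd bq(2) by blast
qed

end
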